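(* Let $\{Z_t\}_{t\ge 0}$ be a theta-positive branching process in varying environment with parameters $(\theta,\{\lambda_t\},\{a_t\})$, where $\theta\in(0,1]$. (1) If $V_\theta<\infty$, then $q<1$, the limit $\lim_{t\to\infty}\mu_t=\mu$ exists with $0<\mu\le\infty$, and $$q=1-\Big(V_\theta+(1+\theta)^{-1}+\theta(1+\theta)^{-1}\mu^{-\theta}\Big)^{-1/\theta}$$ (with $\mu^{-\theta}=0$ if $\mu=\infty$). (2) If $V_\theta=\infty$, then $q=1$ and, as $t\to\infty$, $$\mathrm{P}(Z_t>0)\sim\big(V_{t,\theta}+\theta(1+\theta)^{-1}\mu_t^{-\theta}\big)^{-1/\theta},\qquad m_t\sim\big(\mu_t^{\theta}V_{t,\theta}+\theta(1+\theta)^{-1}\big)^{1/\theta}.$$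
   Context: Theta-positive branching process in varying environment with parameters $(\theta,\{\lambda_t\},\{a_t\})$: fix $\theta\in(0,1]$ and measurable functions $t\mapsto\lambda_t\ge0$ and $t\mapsto a_t$ on $[0,\infty)$ such that $\Lambda_t=\int_0^t\lambda_u\,du<\infty$ for all $t\ge0$ and $0\le a_t\le 1+1/\theta$ for all $t\ge 0$. The process $\{Z_t\}_{t\ge0}$ is the time-inhomogeneous continuous-time Markov branching process on $\{0,1,2,\dots\}$ with $Z_0=1$ (right-continuous sample paths) in which individuals live and reproduce independently; an individual alive at time $t$ dies during $(t,t+\delta)$ with probability $\lambda_t\delta+o(\delta)$ as $\delta\to0$, and an individual dying at time $t$ is instantaneously replaced by $k$ offspring with probability $p_t(k)$, where $k=0$ or $k\ge2$. (So from state $n$ the process jumps to $n-1+k$ at rate $n\lambda_tp_t(k)$ at time $t$.) The offspring probability generating function is $h_t(s)=p_t(0)+\sum_{k\ge2}p_t(k)s^k=1-a_t(1-s)+a_t(1+\theta)^{-1}(1-s)^{1+\theta}$, $0\le s\le 1$; in particular $a_t=\sum_{k\ge 2} kp_t(k)$ is the mean offspring number. Notation: $\mu_t=\mathrm{E}(Z_t)=\exp\{\int_0^t(a_u-1)\,d\Lambda_u\}$, where $d\Lambda_u=\lambda_u\,du$; $m_t=\mathrm{E}(Z_t\mid Z_t>0)$; $q=\lim_{t\to\infty}\mathrm{P}(Z_t=0)$ is the extinction probability; $V_{t,\theta}=\theta(1+\theta)^{-1}\int_0^t\mu_u^{-\theta}\,d\Lambda_u$; $V_\theta=\lim_{t\to\infty}V_{t,\theta}\in[0,\infty]$.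 Here $f(t)\sim g(t)$ means $f(t)/g(t)\to1$. *)

theory Defs
  imports "HOL-Probability.Probability"
begin

(*
  A Markov branching transition function: P s t i is the law at time t of a population that has
  size i at time s.  The branching property says that the individuals of a population evolve
  independently and according to the same law (additivity in the initial size), so that the
  dynamics are determined by a single individual.  Its infinitesimal description is the usual one:
  an individual alive at time t dies during (t, t + d) with probability lam t * d + o(d) and is
  then replaced by k individuals with probability pmf (p t) k, where k ~= 1.

  Since lam is only measurable and locally integrable, the o(d) relations can be required for
  almost every t only (changing lam on a null set changes nothing).  Relations that hold almost
  everywhere do not see singular parts of the death distribution; these are excluded by
  "survival": an individual survives the interval (s, t] with probability
  exp (- integral of lam over [s, t]), and then the population consists of this individual alone.
  Equality may fail there, because a population may also return to size 1.
*)
locale markov_branching_transitions =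
  fixes lam :: "real \<Rightarrow> real"
    and p :: "real \<Rightarrow> nat pmf"
    and P :: "real \<Rightarrow> real \<Rightarrow> nat \<Rightarrow> nat pmf"
  assumes initial: "\<And>s i. 0 \<le> s \<Longrightarrow> P s s i = return_pmf i"
    and chapman_kolmogorov:
      "\<And>s t u i. 0 \<le> s \<Longrightarrow> s \<le> t \<Longrightarrow> t \<le> u \<Longrightarrow>
         P s u i = bind_pmf (P s t i) (\<lambda>j. P t u j)"
    and branching_zero: "\<And>s t. 0 \<le> s \<Longrightarrow> s \<le> t \<Longrightarrow> P s t 0 = return_pmf 0"
    and branching_add:
      "\<And>s t i j. 0 \<le> s \<Longrightarrow> s \<le> t \<Longrightarrow>
         P s t (i + j) = map_pmf (\<lambda>(x, y). x + y) (pair_pmf (P s t i) (P s t j))"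
    and survival:
      "\<And>s t. 0 \<le> s \<Longrightarrow> s \<le> t \<Longrightarrow> exp (- (LBINT u:{s..t}. lam u)) \<le> pmf (P s t 1) 1"
    and death_rate:
      "AE t in lborel. 0 \<le> t \<longrightarrow>
         (\<lambda>d. (1 - pmf (P t (t + d) 1) 1) - lam t * d) \<in> o[at_right 0](\<lambda>d. d)"
    and replacement_rate:
      "AE t in lborel. 0 \<le> t \<longrightarrow>
         (\<forall>k. k \<noteq> 1 \<longrightarrow>
            (\<lambda>d. pmf (P t (t + d) 1) k - lam t * pmf (p t) k * d) \<in> o[at_right 0](\<lambda>d. d))"

definition past_events :: "'w measure \<Rightarrow> (real \<Rightarrow> 'w \<Rightarrow> nat) \<Rightarrow> real \<Rightarrow> 'w set set" where
  "past_events M Z s =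
     sigma_sets (space M) {{\<omega> \<in> space M. Z u \<omega> = i} | u i. 0 \<le> u \<and> u \<le> s}"

(*
  The time index is real; only the times t >= 0 matter.  Right-continuity refers to the
  discrete topology of nat.
*)
locale markov_branching_process =
  prob_space M + markov_branching_transitions lam p P
  for M :: "'w measure"
    and Z :: "real \<Rightarrow> 'w \<Rightarrow> nat"
    and lam :: "real \<Rightarrow> real"
    and p :: "real \<Rightarrow> nat pmf"
    and P :: "real \<Rightarrow> real \<Rightarrow> nat \<Rightarrow> nat pmf" +
  assumes random_variable_Z: "\<And>t. 0 \<le> t \<Longrightarrow> Z t \<in> measurable M (count_space UNIV)"
    and starts_with_one: "AE \<omega> in M. Z 0 \<omega> = 1"
    and right_continuous: "AE \<omega> in M. \<forall>t\<ge>0. continuous (at_right t) (\<lambda>u. Z u \<omega>)"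
    and markov:
      "\<And>s t A i j. 0 \<le> s \<Longrightarrow> s \<le> t \<Longrightarrow> A \<in> past_events M Z s \<Longrightarrow>
         prob (A \<inter> {\<omega> \<in> space M. Z s \<omega> = i \<and> Z t \<omega> = j}) =
         prob (A \<inter> {\<omega> \<in> space M. Z s \<omega> = i}) * pmf (P s t i) j"

definition theta_pgf :: "real \<Rightarrow> real \<Rightarrow> real \<Rightarrow> real" where
  "theta_pgf \<theta> a s = 1 - a * (1 - s) + a * inverse (1 + \<theta>) * (1 - s) powr (1 + \<theta>)"

definition theta_parameters :: "real \<Rightarrow> (real \<Rightarrow> real) \<Rightarrow> (real \<Rightarrow> real) \<Rightarrow> bool" where
  "theta_parameters \<theta> lam a \<longleftrightarrow>
     0 < \<theta> \<and> \<theta> \<le> 1 \<and>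
     set_borel_measurable borel {0..} lam \<and> (\<forall>t\<ge>0. 0 \<le> lam t) \<and>
     (\<forall>t\<ge>0. set_integrable lborel {0..t} lam) \<and>
     set_borel_measurable borel {0..} a \<and> (\<forall>t\<ge>0. 0 \<le> a t \<and> a t \<le> 1 + 1 / \<theta>)"

(*
  The offspring law p t is determined by its generating function, and P is determined by the
  infinitesimal description; so the process depends on the parameters theta, lam, a only.
*)
definition theta_positive_process ::
  "'w measure \<Rightarrow> (real \<Rightarrow> 'w \<Rightarrow> nat) \<Rightarrow> real \<Rightarrow> (real \<Rightarrow> real) \<Rightarrow> (real \<Rightarrow> real) \<Rightarrow> bool" where
  "theta_positive_process M Z \<theta> lam a \<longleftrightarrow>
     theta_parameters \<theta> lam a \<and>
     (\<exists>p P. markov_branching_process M Z lam p P \<and>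
        (\<forall>t\<ge>0. pmf (p t) 1 = 0 \<and>
           (\<forall>s\<in>{0..1}. (\<lambda>k. pmf (p t) k * s ^ k) sums theta_pgf \<theta> (a t) s)))"

definition mean_size :: "'w measure \<Rightarrow> (real \<Rightarrow> 'w \<Rightarrow> nat) \<Rightarrow> real \<Rightarrow> real" where
  "mean_size M Z t = (\<integral>\<omega>. real (Z t \<omega>) \<partial>M)"

(* uniform_measure M A is the conditional probability measure M( . | A) *)
definition conditional_mean_size :: "'w measure \<Rightarrow> (real \<Rightarrow> 'w \<Rightarrow> nat) \<Rightarrow> real \<Rightarrow> real" where
  "conditional_mean_size M Z t =
     (\<integral>\<omega>. real (Z t \<omega>) \<partial>uniform_measure M {\<omega> \<in> space M. 0 < Z t \<omega>})"

definition survival_prob :: "'w measure \<Rightarrow> (real \<Rightarrow> 'w \<Rightarrow> nat) \<Rightarrow> real \<Rightarrow> real" where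
  "survival_prob M Z t = measure M {\<omega> \<in> space M. 0 < Z t \<omega>}"

definition extinction_prob :: "'w measure \<Rightarrow> (real \<Rightarrow> 'w \<Rightarrow> nat) \<Rightarrow> real" where
  "extinction_prob M Z = Lim at_top (\<lambda>t. measure M {\<omega> \<in> space M. Z t \<omega> = 0})"

definition V_at ::
  "'w measure \<Rightarrow> (real \<Rightarrow> 'w \<Rightarrow> nat) \<Rightarrow> real \<Rightarrow> (real \<Rightarrow> real) \<Rightarrow> real \<Rightarrow> real" where
  "V_at M Z \<theta> lam t =
     \<theta> * inverse (1 + \<theta>) * (LBINT u:{0..t}. mean_size M Z u powr (- \<theta>) * lam u)"

definition V_lim ::
  "'w measure \<Rightarrow> (real \<Rightarrow> 'w \<Rightarrow> nat) \<Rightarrow> real \<Rightarrow> (real \<Rightarrow> real) \<Rightarrow> ereal" where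
  "V_lim M Z \<theta> lam = Lim at_top (\<lambda>t. ereal (V_at M Z \<theta> lam t))"

end

theory Submission
  imports Defs
begin

text \<open>
  Fix a time \<open>t\<close> and \<open>x \<in> [0, 1)\<close>, and let \<open>F s\<close> be the generating function, at \<open>x\<close>, of the population
  at time \<open>t\<close> that descends from one individual alive at time \<open>s\<close>. By the branching property and the
  Chapman-Kolmogorov equation, \<open>F s\<close> is the generating function of the population at an intermediate
  time \<open>r\<close>, evaluated at \<open>F r\<close>. Inserting the infinitesimal description for small \<open>r - s\<close> gives the
  backward equation \<open>F' = - lam (h\<^sub>s(F) - F)\<close> in integrated form (\<open>backward_equation\<close>).

  For the theta-positive offspring law this is a Bernoulli equation for \<open>G = 1 - F\<close>:
  \<open>G' = lam ((1 - a) G + a G\<^bsup>1+\<theta>\<^esup> / (1 + \<theta>))\<close>. Hence \<open>G\<^bsup>-\<theta>\<^esup>\<close> solves a linear equation, whose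
  integrating factor is \<open>exp E\<close> with \<open>E = \<theta> \<integral>(1 - a) d\<Lambda>\<close>, and \<open>G 0\<close> is explicit
  (\<open>theta_survival_formula\<close>). Letting \<open>x \<rightarrow> 1\<close> yields the mean \<open>\<mu>\<^sub>t = exp (- E t / \<theta>)\<close>, so that
  \<open>exp E = \<mu>\<^bsup>-\<theta>\<^esup>\<close>; taking \<open>x = 0\<close> yields
  \<open>P(Z\<^sub>t > 0)\<^bsup>-\<theta>\<^esup> = V\<^sub>t + 1/(1+\<theta>) + \<theta>/(1+\<theta>) \<mu>\<^sub>t\<^bsup>-\<theta>\<^esup>\<close> (\<open>theta_process_closed_form\<close>).

  The theorem is read off from this identity. As \<open>V\<^sub>t\<close> is nondecreasing, it either converges or
  tends to infinity. If it converges, then so does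
  \<open>\<mu>\<^sub>t\<^bsup>-\<theta>\<^esup> = 1 + (1 + \<theta>) V\<^sub>t - \<theta> \<integral> a \<mu>\<^bsup>-\<theta>\<^esup> d\<Lambda>\<close>: the last integral is nondecreasing, and bounded because
  \<open>a\<close> is. If \<open>V\<^sub>t\<close> tends to infinity, then the constant \<open>1/(1+\<theta>)\<close> becomes negligible.

  The delicate point is to integrate the infinitesimal relations, which hold almost everywhere only.
  The survival condition bounds the increments of \<open>F\<close> by those of \<open>\<Lambda>\<close>, so \<open>\<Lambda> + F\<close> and \<open>\<Lambda> - F\<close> are
  nondecreasing. For a nondecreasing function, Fatou's lemma applied to difference quotients shows
  that the integral of a lower bound of its derivative is at most its increment
  (\<open>integral_le_increment_if_mono\<close>). Used for both functions, this bounds the increment of \<open>F\<close> from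
  both sides. That the quotients of \<open>\<Lambda>\<close> are asymptotically at least \<open>lam\<close> almost everywhere follows
  from the death rate, since by survival the size differs from \<open>1\<close> at the end of an interval with
  probability at most \<open>\<integral> d\<Lambda>\<close>.
\<close>

section \<open>Calculus of indefinite integrals\<close>

lemma set_integral_Icc_combine:
  fixes f :: "real \<Rightarrow> real"
  assumes "a \<le> b" "b \<le> c" and f: "set_integrable lborel {a..c} f"
  shows "(LBINT x:{a..c}. f x) = (LBINT x:{a..b}. f x) + (LBINT x:{b..c}. f x)"
proof -
  have "set_integrable lborel {a..b} f" "set_integrable lborel {b..c} f"
    using assms by (auto intro: set_integrable_subset[OF f])
  then show ?thesis
    using set_borel_integral_eq_integral[OF f] assms
    by (simp add: set_borel_integral_eq_integral(2) Henstock_Kurzweil_Integration.integral_combine)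
qed

lemma set_integral_singleton: "(LBINT x:{a::real}. f x) = (0::real)"
proof -
  have "AE x in lborel. indicator {a} x *\<^sub>R f x = 0"
    using AE_lborel_singleton[of a] by eventually_elim (auto simp: indicator_def)
  then show ?thesis
    unfolding set_lebesgue_integral_def by (simp add: integral_eq_zero_AE)
qed

lemma set_integral_Icc_nonneg:
  fixes f :: "real \<Rightarrow> real"
  assumes "\<And>x. x \<in> A \<Longrightarrow> 0 \<le> f x"
  shows "0 \<le> (LBINT x:A. f x)"
  unfolding set_lebesgue_integral_def
  by (rule integral_nonneg_AE) (use assms in \<open>auto simp: indicator_def\<close>)

lemma abs_set_integral_le:
  fixes f g :: "real \<Rightarrow> real"
  assumes "set_integrable lborel A f" "set_integrable lborel A g" "\<And>x. x \<in> A \<Longrightarrow> \<bar>f x\<bar> \<le> g x"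
  shows "\<bar>LBINT x:A. f x\<bar> \<le> (LBINT x:A. g x)"
proof -
  have 1: "(LBINT x:A. f x) \<le> (LBINT x:A. g x)"
    by (rule set_integral_mono) (use assms in \<open>auto dest!: assms(3)\<close>)
  have "(LBINT x:A. - f x) \<le> (LBINT x:A. g x)"
    by (rule set_integral_mono) (use assms in \<open>auto simp: set_integrable_def dest!: assms(3)\<close>)
  with 1 show ?thesis using assms(1) by (simp add: set_integral_uminus)
qed

lemma continuous_on_indefinite_integral:
  fixes f u :: "real \<Rightarrow> real"
  assumes u: "set_integrable lborel {a..b} u"
    and f: "\<And>s. a \<le> s \<Longrightarrow> s \<le> b \<Longrightarrow> f s = c + (LBINT x:{a..s}. u x)"
  shows "continuous_on {a..b} f"
proof -
  have eq: "f s = c + integral {a..s} u" if "s \<in> {a..b}" for s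
    using that set_borel_integral_eq_integral(2)[OF set_integrable_subset[OF u, of "{a..s}"]] f
    by auto
  have "continuous_on {a..b} (\<lambda>s. c + integral {a..s} u)"
    using set_borel_integral_eq_integral(1)[OF u]
    by (intro continuous_intros indefinite_integral_continuous_1)
  then show ?thesis by (subst continuous_on_cong[OF refl eq]) auto
qed

lemma set_integrable_mult_continuous:
  fixes f g :: "real \<Rightarrow> real"
  assumes g: "continuous_on {a..b} g" and u: "set_integrable lborel {a..b} u"
  shows "set_integrable lborel {a..b} (\<lambda>x. g x * u x)"
proof -
  have "bounded (g ` {a..b})"
    using compact_continuous_image[OF g] compact_imp_bounded by blast
  then obtain B where "\<forall>x\<in>{a..b}. \<bar>g x\<bar> \<le> B"
    by (auto simp: bounded_iff)
  then have B: "\<bar>g x\<bar> \<le> B" if "x \<in> {a..b}" for x using that by blast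
  show ?thesis
  proof (rule set_integrable_bound)
    show "set_integrable lborel {a..b} (\<lambda>x. B * u x)" using u by simp
    have 1: "(\<lambda>x. indicator {a..b} x *\<^sub>R g x) \<in> borel_measurable borel"
      using set_measurable_continuous_on[of "{a..b}" g] g by (simp add: set_borel_measurable_def)
    have 2: "(\<lambda>x. indicator {a..b} x *\<^sub>R u x) \<in> borel_measurable borel"
      using u by (auto simp: set_integrable_def dest: borel_measurable_integrable)
    have "(\<lambda>x. (indicator {a..b} x *\<^sub>R g x) * (indicator {a..b} x *\<^sub>R u x)) \<in> borel_measurable borel"
      using 1 2 by (rule borel_measurable_times)
    also have "(\<lambda>x. (indicator {a..b} x *\<^sub>R g x) * (indicator {a..b} x *\<^sub>R u x))
       = (\<lambda>x. indicator {a..b} x *\<^sub>R (g x * u x))" by (auto simp: indicator_def)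
    finally show "set_borel_measurable lborel {a..b} (\<lambda>x. g x * u x)"
      by (simp add: set_borel_measurable_def)
    show "AE x in lborel. x \<in> {a..b} \<longrightarrow> norm (g x * u x) \<le> norm (B * u x)"
    proof (rule AE_I2, rule impI)
      fix x assume "x \<in> {a..b}"
      with B[of x] have "\<bar>g x\<bar> \<le> \<bar>B\<bar>" by linarith
      then show "norm (g x * u x) \<le> norm (B * u x)" by (simp add: abs_mult mult_right_mono)
    qed
  qed
qed

text \<open>
  The derivative \<open>u\<close> of \<open>f\<close> exists in the integrated sense only, so \<open>\<psi> \<circ> f\<close> cannot be differentiated
  pointwise. Instead, near each point the defect of the claimed formula on a small interval is at most
  \<open>e\<close> times the integral of \<open>\<bar>u\<bar>\<close> over it; both sides of this bound are additive over adjacent intervals, so the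
  bound passes from small intervals to \<open>[a, b]\<close>.
\<close>
lemma chain_rule_indefinite_integral:
  fixes f u \<psi> \<psi>' :: "real \<Rightarrow> real"
  assumes ab: "a \<le> b" and u: "set_integrable lborel {a..b} u"
    and f: "\<And>s. a \<le> s \<Longrightarrow> s \<le> b \<Longrightarrow> f s = f a + (LBINT x:{a..s}. u x)"
    and der: "\<And>s. a \<le> s \<Longrightarrow> s \<le> b \<Longrightarrow> (\<psi> has_real_derivative \<psi>' (f s)) (at (f s))"
    and cont: "continuous_on {a..b} (\<lambda>s. \<psi>' (f s))"
  shows "\<psi> (f b) = \<psi> (f a) + (LBINT x:{a..b}. \<psi>' (f x) * u x)"
proof -
  let ?v = "\<lambda>x. \<psi>' (f x) * u x"
  have v: "set_integrable lborel {a..b} ?v" by (rule set_integrable_mult_continuous[OF cont u])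
  have inc: "f r - f s = (LBINT x:{s..r}. u x)" if "a \<le> s" "s \<le> r" "r \<le> b" for s r
    using f[of r] f[of s] that
      set_integral_Icc_combine[of a s r u, OF _ _ set_integrable_subset[OF u]] by auto
  have cf: "continuous_on {a..b} f" by (rule continuous_on_indefinite_integral[OF u f])
  define D where "D s r = \<psi> (f r) - \<psi> (f s) - (LBINT x:{s..r}. ?v x)" for s r
  define A where "A s r = (LBINT x:{s..r}. \<bar>u x\<bar>)" for s r
  have ua: "set_integrable lborel {a..b} (\<lambda>x. \<bar>u x\<bar>)" using u by (rule set_integrable_abs)
  have main: "\<bar>D a b\<bar> \<le> e * A a b" if e: "e > 0" for e
  proof -
    have "a \<le> a \<and> b \<le> b \<longrightarrow> \<bar>D a b\<bar> \<le> e * A a b"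
      using ab
    proof (induction rule: Bolzano[where P = "\<lambda>s r. a \<le> s \<and> r \<le> b \<longrightarrow> \<bar>D s r\<bar> \<le> e * A s r", consumes 1, case_names trans local])
      case (trans s q r)
      show ?case
      proof
        assume *: "a \<le> s \<and> r \<le> b"
        have "D s r = D s q + D q r"
          using trans(3,4) * set_integral_Icc_combine[of s q r ?v, OF _ _ set_integrable_subset[OF v]]
          by (auto simp: D_def)
        moreover have "A s r = A s q + A q r"
          using trans(3,4) * set_integral_Icc_combine[of s q r, OF _ _ set_integrable_subset[OF ua]]
          by (auto simp: A_def)
        ultimately show "\<bar>D s r\<bar> \<le> e * A s r"
          using trans * by (simp add: algebra_simps)
      qed
    next
      case (local x)
      \<comment> \<open>The defect near \<open>x\<close> consists of the linearization errors of \<open>\<psi>\<close> on both sides of \<open>x\<close> and the oscillation of \<open>\<psi>' \<circ> f\<close>.\<close>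
      have "\<exists>d>0. \<forall>y. \<bar>y - f x\<bar> < d \<longrightarrow> \<bar>\<psi> y - \<psi> (f x) - \<psi>' (f x) * (y - f x)\<bar> \<le> e/2 * \<bar>y - f x\<bar>"
        proof -
        have "\<forall>e>0. \<exists>d>0. \<forall>y. \<bar>y - f x\<bar> < d \<longrightarrow> \<bar>\<psi> y - \<psi> (f x) - \<psi>' (f x) * (y - f x)\<bar> \<le> e * \<bar>y - f x\<bar>"
          using der[OF local] unfolding has_field_derivative_def has_derivative_at_alt by simp
        then show ?thesis using e half_gt_zero by blast
      qed
      then obtain d1 where d1: "d1 > 0" "\<And>y. \<bar>y - f x\<bar> < d1 \<Longrightarrow>
          \<bar>\<psi> y - \<psi> (f x) - \<psi>' (f x) * (y - f x)\<bar> \<le> e/2 * \<bar>y - f x\<bar>" by blast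
      have "\<exists>d>0. \<forall>y\<in>{a..b}. dist y x < d \<longrightarrow> dist (f y) (f x) < d1"
        using cf local d1(1) unfolding continuous_on_iff by auto
      then obtain d2 where d2: "d2 > 0" "\<And>y. y \<in> {a..b} \<Longrightarrow> \<bar>y - x\<bar> < d2 \<Longrightarrow> \<bar>f y - f x\<bar> < d1"
        by (auto simp: dist_real_def)
      have "\<exists>d>0. \<forall>y\<in>{a..b}. dist y x < d \<longrightarrow> dist (\<psi>' (f y)) (\<psi>' (f x)) < e/2"
        using cont local half_gt_zero[OF e] unfolding continuous_on_iff by (meson atLeastAtMost_iff)
      then obtain d3 where d3: "d3 > 0" "\<And>y. y \<in> {a..b} \<Longrightarrow> \<bar>y - x\<bar> < d3 \<Longrightarrow> \<bar>\<psi>' (f y) - \<psi>' (f x)\<bar> < e/2"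
        by (auto simp: dist_real_def)
      show ?case
      proof (intro exI[of _ "min d2 d3"] conjI allI impI; (elim conjE)?)
        show "min d2 d3 > 0" using d2 d3 by simp
        fix s r assume h: "s \<le> x" "x \<le> r" "r - s < min d2 d3" "a \<le> s" "r \<le> b"
        let ?c = "\<psi>' (f x)"
        have us: "set_integrable lborel {s..r} u" and vs: "set_integrable lborel {s..r} ?v"
          and uas: "set_integrable lborel {s..r} (\<lambda>x. \<bar>u x\<bar>)"
          using h by (auto intro: set_integrable_subset[OF u] set_integrable_subset[OF v] set_integrable_subset[OF ua])
        have A: "A s r = A s x + A x r"
          using h set_integral_Icc_combine[of s x r "\<lambda>x. \<bar>u x\<bar>", OF _ _ uas] by (simp add: A_def)
        have fr: "\<bar>f r - f x\<bar> \<le> A x r" "\<bar>f s - f x\<bar> \<le> A s x"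
          using inc[of x r] inc[of s x] h
            abs_set_integral_le[of "{x..r}" u "\<lambda>x. \<bar>u x\<bar>", OF set_integrable_subset[OF us] set_integrable_subset[OF uas]]
            abs_set_integral_le[of "{s..x}" u "\<lambda>x. \<bar>u x\<bar>", OF set_integrable_subset[OF us] set_integrable_subset[OF uas]]
          by (auto simp: A_def)
        have 1: "\<bar>\<psi> (f r) - \<psi> (f x) - ?c * (f r - f x)\<bar> \<le> e/2 * A x r"
          by (rule order_trans[OF d1(2)[OF d2(2)]]) (use h e fr in auto)
        have 2: "\<bar>\<psi> (f s) - \<psi> (f x) - ?c * (f s - f x)\<bar> \<le> e/2 * A s x"
          by (rule order_trans[OF d1(2)[OF d2(2)]]) (use h e fr in auto)
        have "?c * (f r - f s) - (LBINT y:{s..r}. ?v y) = (LBINT y:{s..r}. ?c * u y - ?v y)"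
          using inc[of s r] h us vs by (simp add: set_integral_diff)
        also have "\<bar>\<dots>\<bar> \<le> (LBINT y:{s..r}. e/2 * \<bar>u y\<bar>)"
        proof (rule abs_set_integral_le)
          show "set_integrable lborel {s..r} (\<lambda>y. ?c * u y - ?v y)" using us vs by (simp add: set_integral_diff)
          show "set_integrable lborel {s..r} (\<lambda>y. e/2 * \<bar>u y\<bar>)"
            by (rule set_integrable_mult_right) (rule uas)
          fix y assume "y \<in> {s..r}"
          then have "\<bar>\<psi>' (f y) - ?c\<bar> < e/2" using h by (intro d3(2)) (auto simp: abs_less_iff)
          then have "\<bar>?c - \<psi>' (f y)\<bar> \<le> e/2" by linarith
          then have "\<bar>?c - \<psi>' (f y)\<bar> * \<bar>u y\<bar> \<le> e/2 * \<bar>u y\<bar>" by (rule mult_right_mono) simp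
          then show "\<bar>?c * u y - ?v y\<bar> \<le> e/2 * \<bar>u y\<bar>" by (simp add: abs_mult[symmetric] algebra_simps)
        qed
        also have "\<dots> = e/2 * A s r" by (simp add: A_def)
        finally have 3: "\<bar>?c * (f r - f s) - (LBINT y:{s..r}. ?v y)\<bar> \<le> e/2 * A s r" .
        have "D s r = (\<psi> (f r) - \<psi> (f x) - ?c * (f r - f x)) - (\<psi> (f s) - \<psi> (f x) - ?c * (f s - f x))
           + (?c * (f r - f s) - (LBINT y:{s..r}. ?v y))"
          by (simp add: D_def algebra_simps)
        then have "\<bar>D s r\<bar> \<le> e/2 * A x r + e/2 * A s x + e/2 * A s r" using 1 2 3 by linarith
        then show "\<bar>D s r\<bar> \<le> e * A s r" using A by (simp add: algebra_simps)
      qed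
    qed
    then show ?thesis by simp
  qed
  have Ann: "0 \<le> A a b" unfolding A_def by (rule set_integral_Icc_nonneg) simp
  have "\<bar>D a b\<bar> \<le> 0"
  proof (rule field_le_epsilon)
    fix e :: real assume e: "e > 0"
    have "\<bar>D a b\<bar> \<le> e / (A a b + 1) * A a b" using main[of "e / (A a b + 1)"] e Ann by simp
    also have "\<dots> \<le> e" using e Ann by (simp add: field_simps)
    finally show "\<bar>D a b\<bar> \<le> 0 + e" by simp
  qed
  then show ?thesis by (simp add: D_def)
qed

section \<open>Integrating one-sided derivatives of monotone functions\<close>

text \<open>
  The integral over \<open>[a, b]\<close> of the difference quotient with step \<open>d\<close> is the mean of \<open>H\<close> over
  \<open>[b, b + d]\<close> minus its mean over \<open>[a, a + d]\<close>, which is at most \<open>H (b + d) - H a\<close>. Fatou's lemma,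
  applicable because the quotients of a nondecreasing function are nonnegative, lets \<open>d\<close> tend to \<open>0\<close>.
  Equality can fail, as the Cantor function shows.
\<close>
lemma integral_le_increment_if_mono:
  fixes H h :: "real \<Rightarrow> real"
  assumes ab: "a \<le> b" and mono: "\<And>s r. a \<le> s \<Longrightarrow> s \<le> r \<Longrightarrow> r \<le> b + 1 \<Longrightarrow> H s \<le> H r"
    and cont: "continuous_on {a..b + 1} H"
    and h: "set_integrable lborel {a..b} h" "\<And>s. s \<in> {a..b} \<Longrightarrow> 0 \<le> h s"
    and der: "AE s in lborel. s \<in> {a..<b} \<longrightarrow> (\<forall>e>0. \<forall>\<^sub>F n in sequentially.
                h s - e \<le> (H (s + 1 / Suc n) - H s) * Suc n)"
  shows "(LBINT s:{a..b}. h s) \<le> H b - H a"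
proof -
  define Q where "Q n s = indicator {a..b} s *\<^sub>R ((H (s + 1 / Suc n) - H s) * Suc n)" for n s
  have d01: "0 < 1 / real (Suc n)" "1 / real (Suc n) \<le> 1" for n by simp_all
  have csub: "continuous_on S H" if "S \<subseteq> {a..b + 1}" for S
    using continuous_on_subset[OF cont that] .
  have cq: "continuous_on {a..b} (\<lambda>s. (H (s + 1 / Suc n) - H s) * Suc n)" for n
    by (intro continuous_intros csub continuous_on_compose2[OF cont])
      (use d01[of n] in \<open>auto simp: add_mono image_subset_iff simp del: of_nat_Suc\<close>)
  have meas: "Q n \<in> borel_measurable borel" for n
    unfolding Q_def using set_measurable_continuous_on[OF _ cq[of n]] by (simp add: set_borel_measurable_def)
  have Qnn: "0 \<le> Q n s" for n s
  proof (cases "s \<in> {a..b}")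
    case True
    then have "H s \<le> H (s + 1 / Suc n)" using d01[of n] by (intro mono add_mono) (auto simp del: of_nat_Suc)
    then show ?thesis by (simp add: Q_def del: of_nat_Suc)
  qed (simp add: Q_def)
  have Qint: "(\<integral>\<^sup>+ s. ennreal (Q n s) \<partial>lborel) \<le> ennreal (H (b + 1 / Suc n) - H a)" for n
  proof -
    let ?d = "1 / real (Suc n)"
    have d: "?d > 0" "?d \<le> 1" by (rule d01)+
    have ab1: "a + ?d \<le> b + 1" by (rule add_mono[OF ab d(2)])
    have si: "set_integrable lborel {a..b} (\<lambda>s. (H (s + ?d) - H s) * Suc n)"
      using cq[of n] by (intro borel_integrable_atLeastAtMost') auto
    have "(\<integral>\<^sup>+ s. ennreal (Q n s) \<partial>lborel) = ennreal (LBINT s:{a..b}. (H (s + ?d) - H s) * Suc n)"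
      unfolding Q_def set_lebesgue_integral_def
      by (rule nn_integral_eq_integral[OF si[unfolded set_integrable_def]])
        (use Qnn[of n] in \<open>auto simp: Q_def\<close>)
    also have "(LBINT s:{a..b}. (H (s + ?d) - H s) * Suc n) = integral {a..b} (\<lambda>s. (H (s + ?d) - H s) * Suc n)"
      by (rule set_borel_integral_eq_integral(2)[OF si])
    also have "\<dots> = (integral {a..b} (\<lambda>s. H (s + ?d)) - integral {a..b} H) * Suc n"
    proof -
      have "continuous_on {a..b} (\<lambda>s. H (s + ?d))"
        by (rule continuous_on_compose2[OF cont])
          (use d in \<open>auto intro!: continuous_intros simp: image_subset_iff simp del: of_nat_Suc\<close>)
      moreover have "continuous_on {a..b} H" by (rule csub) auto
      ultimately show ?thesis
        by (simp add: integral_diff integrable_continuous_interval del: of_nat_Suc)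
    qed
    also have "integral {a..b} (\<lambda>s. H (s + ?d)) = integral {a+?d..b+?d} H"
      using integral_shift[of a ?d b H] csub[of "{a + ?d..b + ?d}"] d by (auto simp: o_def simp del: of_nat_Suc)
    also have "integral {a+?d..b+?d} H - integral {a..b} H
       = integral {b..b+?d} H - integral {a..a+?d} H"
    proof -
      have i: "H integrable_on {a..b+?d}" by (rule integrable_continuous_interval[OF csub]) (use d in \<open>auto simp del: of_nat_Suc\<close>)
      have "integral {a..a+?d} H + integral {a+?d..b+?d} H = integral {a..b+?d} H"
        using i ab d by (intro Henstock_Kurzweil_Integration.integral_combine) (auto simp del: of_nat_Suc)
      moreover have "integral {a..b} H + integral {b..b+?d} H = integral {a..b+?d} H"
        using i ab d by (intro Henstock_Kurzweil_Integration.integral_combine) (auto simp del: of_nat_Suc)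
      ultimately show ?thesis by linarith
    qed
    also have "\<dots> * Suc n \<le> (H (b + ?d) * ?d - H a * ?d) * Suc n"
    proof (intro mult_right_mono diff_mono)
      have "integral {b..b+?d} H \<le> integral {b..b+?d} (\<lambda>_. H (b + ?d))"
        using ab d ab1 by (intro integral_le integrable_continuous_interval csub mono) (auto simp del: of_nat_Suc)
      then show "integral {b..b+?d} H \<le> H (b + ?d) * ?d" by (simp add: mult.commute del: of_nat_Suc)
      have "integral {a..a+?d} (\<lambda>_. H a) \<le> integral {a..a+?d} H"
        using ab d ab1 by (intro integral_le integrable_continuous_interval csub mono) (auto simp del: of_nat_Suc)
      then show "H a * ?d \<le> integral {a..a+?d} H" by (simp add: mult.commute del: of_nat_Suc)
    qed simp
    also have "\<dots> = (H (b + ?d) - H a) * (?d * Suc n)" by (simp only: left_diff_distrib mult.assoc)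
    also have "?d * Suc n = 1" by simp
    finally show ?thesis by (simp only: mult_1_right ennreal_leI)
  qed
  have "ennreal (LBINT s:{a..b}. h s) = (\<integral>\<^sup>+ s. ennreal (indicator {a..b} s *\<^sub>R h s) \<partial>lborel)"
    unfolding set_lebesgue_integral_def
    by (rule nn_integral_eq_integral[symmetric]) (use h in \<open>auto simp: set_integrable_def indicator_def\<close>)
  also have "\<dots> \<le> (\<integral>\<^sup>+ s. liminf (\<lambda>n. ennreal (Q n s)) \<partial>lborel)"
  proof (rule nn_integral_mono_AE)
    show "AE s in lborel. ennreal (indicator {a..b} s *\<^sub>R h s) \<le> liminf (\<lambda>n. ennreal (Q n s))"
      using der AE_lborel_singleton[of b]
    proof eventually_elim
      case (elim s)
      show ?case
      proof (cases "s \<in> {a..<b}")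
        case True
        have "y \<le> liminf (\<lambda>n. ennreal (Q n s))" if y: "y < ennreal (h s)" for y
        proof -
          obtain y' where y': "y = ennreal y'" "0 \<le> y'" using y by (cases y) auto
          then have "h s - y' > 0" using y by (simp add: ennreal_less_iff)
          then have "\<forall>\<^sub>F n in sequentially. h s - (h s - y') \<le> (H (s + 1 / Suc n) - H s) * Suc n"
            using elim(1) True by blast
          then have "\<forall>\<^sub>F n in sequentially. y \<le> ennreal (Q n s)"
            by eventually_elim (use True y' in \<open>auto simp: Q_def intro!: ennreal_leI\<close>)
          then show ?thesis by (rule Liminf_bounded)
        qed
        then have "ennreal (h s) \<le> liminf (\<lambda>n. ennreal (Q n s))"
          by (rule dense_le)
        with True show ?thesis by auto
      next
        case False
        with elim(2) have "s \<notin> {a..b}" by auto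
        then show ?thesis by simp
      qed
    qed
  qed
  also have "\<dots> \<le> liminf (\<lambda>n. \<integral>\<^sup>+ s. ennreal (Q n s) \<partial>lborel)"
    by (rule nn_integral_liminf) (use meas in simp)
  also have "\<dots> \<le> liminf (\<lambda>n. ennreal (H (b + 1 / Suc n) - H a))"
    by (rule Liminf_mono) (use Qint in simp)
  also have "\<dots> = ennreal (H b - H a)"
  proof (rule lim_imp_Liminf)
    have "(\<lambda>n. b + 1 / Suc n) \<longlonglongrightarrow> b + 0"
      by (intro tendsto_intros LIMSEQ_Suc lim_1_over_n)
    moreover have "\<forall>\<^sub>F n in sequentially. b + 1 / Suc n \<in> {a..b + 1}"
      using ab d01 by (intro always_eventually) (auto simp: add_increasing2 simp del: of_nat_Suc)
    ultimately have "(\<lambda>n. H (b + 1 / Suc n)) \<longlonglongrightarrow> H b"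
      using continuous_on_tendsto_compose[OF cont, of "\<lambda>n. b + 1 / Suc n" b sequentially] ab
      by (simp del: of_nat_Suc)
    then show "(\<lambda>n. ennreal (H (b + 1 / Suc n) - H a)) \<longlonglongrightarrow> ennreal (H b - H a)"
      by (intro tendsto_ennrealI tendsto_intros)
  qed simp
  finally show ?thesis
    using mono[of a b] ab by (simp add: ennreal_le_iff)
qed

section \<open>Probability generating functions\<close>

definition pgf :: "nat pmf \<Rightarrow> real \<Rightarrow> real" where
  "pgf N x = measure_pmf.expectation N (\<lambda>k. x ^ k)"

lemma integrable_pgf: "0 \<le> x \<Longrightarrow> x \<le> 1 \<Longrightarrow> integrable (measure_pmf N) (\<lambda>k. x ^ k :: real)"
  by (rule measure_pmf.integrable_const_bound[where B = 1]) (auto simp: power_le_one)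

lemma ennreal_pgf:
  assumes "0 \<le> x" "x \<le> 1"
  shows "ennreal (pgf N x) = (\<integral>\<^sup>+ k. ennreal (x ^ k) \<partial>N)"
  unfolding pgf_def
  by (rule nn_integral_eq_integral[symmetric]) (use assms integrable_pgf in auto)

lemma pgf_nonneg: "0 \<le> x \<Longrightarrow> 0 \<le> pgf N x"
  unfolding pgf_def by (intro integral_nonneg_AE) auto

lemma pgf_le_1: "0 \<le> x \<Longrightarrow> x \<le> 1 \<Longrightarrow> pgf N x \<le> 1"
  unfolding pgf_def by (rule measure_pmf.integral_le_const) (auto simp: integrable_pgf power_le_one)

lemma pgf_return [simp]: "pgf (return_pmf n) x = x ^ n"
  by (simp add: pgf_def)

lemma pgf_0: "pgf N 0 = pmf N 0"
proof -
  have "pgf N 0 = measure_pmf.expectation N (indicator {0})"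
    unfolding pgf_def by (intro Bochner_Integration.integral_cong) (auto simp: power_0_left indicator_def)
  then show ?thesis by (simp add: measure_pmf_single)
qed

lemma pgf_bind:
  assumes "0 \<le> x" "x \<le> 1" "0 \<le> y" "y \<le> 1" "\<And>j. pgf (K j) x = y ^ j"
  shows "pgf (bind_pmf N K) x = pgf N y"
proof -
  have "ennreal (pgf (bind_pmf N K) x) = (\<integral>\<^sup>+ j. \<integral>\<^sup>+ k. ennreal (x ^ k) \<partial>K j \<partial>N)"
    using assms(1,2) by (simp add: ennreal_pgf)
  also have "\<dots> = (\<integral>\<^sup>+ j. ennreal (y ^ j) \<partial>N)"
    using assms(1,2) by (simp only: ennreal_pgf[symmetric] assms(5))
  also have "\<dots> = ennreal (pgf N y)"
    using assms(3,4) by (simp add: ennreal_pgf)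
  finally have "ennreal (pgf (bind_pmf N K) x) = ennreal (pgf N y)" .
  then show ?thesis using assms by (simp add: pgf_nonneg)
qed

lemma pgf_convolution:
  assumes "0 \<le> x" "x \<le> 1"
  shows "pgf (map_pmf (\<lambda>(m, n). m + n) (pair_pmf A B)) x = pgf A x * pgf B x"
proof -
  have "ennreal (pgf (map_pmf (\<lambda>(m, n). m + n) (pair_pmf A B)) x)
      = (\<integral>\<^sup>+ z. ennreal (x ^ (fst z + snd z)) \<partial>pair_pmf A B)"
    unfolding ennreal_pgf[OF assms] by (simp add: case_prod_unfold)
  also have "\<dots> = (\<integral>\<^sup>+ m. \<integral>\<^sup>+ n. ennreal (x ^ m) * ennreal (x ^ n) \<partial>B \<partial>A)"
    unfolding nn_integral_pair_pmf' using assms by (simp add: power_add ennreal_mult)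
  also have "\<dots> = ennreal (pgf A x) * ennreal (pgf B x)"
    unfolding ennreal_pgf[OF assms] by (subst nn_integral_cmult, simp, subst nn_integral_multc) simp_all
  also have "\<dots> = ennreal (pgf A x * pgf B x)" using assms by (simp add: ennreal_mult pgf_nonneg)
  finally show ?thesis using assms by (simp add: pgf_nonneg)
qed

lemma expectation_pmf_nat_sums:
  fixes f :: "nat \<Rightarrow> real"
  assumes "integrable (measure_pmf N) f"
  shows "(\<lambda>k. pmf N k * f k) sums measure_pmf.expectation N f"
proof -
  have d: "measure_pmf N = density (count_space UNIV) (\<lambda>k. ennreal (pmf N k))"
    by (rule measure_pmf_eq_density)
  have i: "integrable (count_space UNIV) (\<lambda>k. pmf N k * f k)"
    using assms unfolding d by (subst (asm) integrable_real_density) auto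
  have e: "measure_pmf.expectation N f = (\<integral>k. pmf N k * f k \<partial>count_space UNIV)"
    unfolding d by (subst integral_real_density) auto
  show ?thesis using sums_integral_count_space_nat[OF i] unfolding e .
qed

lemma pgf_sums: "0 \<le> x \<Longrightarrow> x \<le> 1 \<Longrightarrow> (\<lambda>k. pmf N k * x ^ k) sums pgf N x"
  unfolding pgf_def by (intro expectation_pmf_nat_sums integrable_pgf)

lemma pgf_minus_id_sums:
  assumes "0 \<le> x" "x \<le> 1"
  shows "(\<lambda>k. (if k = 1 then 0 else pmf N k) * (x ^ k - x)) sums (pgf N x - x)"
proof -
  have "(\<lambda>k. pmf N k * x ^ k - pmf N k * 1 ^ k * x) sums (pgf N x - pgf N 1 * x)"
    using assms by (intro sums_diff sums_mult2 pgf_sums) auto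
  also have "pgf N 1 = 1" by (simp add: pgf_def)
  also have "(\<lambda>k. pmf N k * x ^ k - pmf N k * 1 ^ k * x) = (\<lambda>k. (if k = 1 then 0 else pmf N k) * (x ^ k - x))"
    by (auto simp: fun_eq_iff algebra_simps)
  finally show ?thesis by simp
qed

lemma pmf_not_1_sums: "(\<lambda>k. if k = 1 then 0 else pmf N k) sums (1 - pmf N 1)" for N :: "nat pmf"
proof -
  have "(\<lambda>k. pmf N k * 1 ^ k - (if k = 1 then pmf N 1 else 0)) sums (pgf N 1 - pmf N 1)"
    by (intro sums_diff pgf_sums sums_single) auto
  also have "(\<lambda>k. pmf N k * 1 ^ k - (if k = 1 then pmf N 1 else 0)) = (\<lambda>k. if k = 1 then 0 else pmf N k)"
    by (auto simp: fun_eq_iff)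
  finally show ?thesis by (simp add: pgf_def)
qed

lemma abs_power_minus_id_le_1:
  fixes x :: real
  assumes "0 \<le> x" "x \<le> 1"
  shows "\<bar>x ^ k - x\<bar> \<le> 1"
  using assms zero_le_power[of x k] power_le_one[of x k] unfolding abs_le_iff by linarith

text \<open>
  The terms \<open>k \<noteq> 1\<close> alone contribute to the difference, and each by at most its probability. With \<open>N\<close>
  the law of a population after a short time, this turns the probability of a change into a
  modulus of continuity.
\<close>
lemma abs_pgf_minus_id_le:
  assumes "0 \<le> x" "x \<le> 1"
  shows "\<bar>pgf N x - x\<bar> \<le> 1 - pmf N 1"
proof -
  let ?q = "\<lambda>k. if k = 1 then 0 else pmf N k"
  have "norm (\<Sum>k. ?q k * (x ^ k - x)) \<le> (\<Sum>k. ?q k)"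
  proof (rule norm_suminf_le)
    show "summable ?q" using pmf_not_1_sums by (rule sums_summable)
    show "norm (?q k * (x ^ k - x)) \<le> ?q k" for k
      using mult_left_mono[OF abs_power_minus_id_le_1[OF assms, of k], of "?q k"] by (simp add: abs_mult)
  qed
  then show ?thesis
    using sums_unique[OF pgf_minus_id_sums[OF assms, of N]] sums_unique[OF pmf_not_1_sums[of N]] by simp
qed

lemma pgf_le_linear:
  assumes "0 \<le> x" "x \<le> 1"
  shows "pgf N x \<le> 1 - pmf N 1 * (1 - x)"
proof -
  let ?f = "\<lambda>k. (1::real) - (1 - x) * indicator {1::nat} k"
  have i: "integrable (measure_pmf N) (indicator {1} :: nat \<Rightarrow> real)"
    by (rule measure_pmf.integrable_const_bound[where B = 1]) auto
  have "pgf N x \<le> measure_pmf.expectation N ?f"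
    unfolding pgf_def
  proof (rule integral_mono)
    show "integrable (measure_pmf N) ?f" using i by simp
    show "x ^ k \<le> ?f k" for k using assms by (auto simp: indicator_def power_le_one)
  qed (use assms in \<open>simp add: integrable_pgf\<close>)
  also have "\<dots> = 1 - (1 - x) * pmf N 1" using i by (simp add: measure_pmf_single)
  finally show ?thesis by (simp add: algebra_simps)
qed

text \<open>
  Pointwise convergence together with convergence of the total masses is convergence in \<open>\<ell>\<^sup>1\<close>
  (Scheffe). Here \<open>A\<close> will be the rescaled transition probabilities over a short interval: the rate of
  leaving state \<open>1\<close> equals the sum of the rates of all replacements, so no mass escapes to infinity.
\<close>
lemma tendsto_suminf_mult_Scheffe:
  fixes A :: "nat \<Rightarrow> nat \<Rightarrow> real" and B :: "nat \<Rightarrow> nat \<Rightarrow> real"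
  assumes A: "\<And>n k. 0 \<le> A n k" "\<And>n. A n sums S n" "\<And>k. 0 \<le> L k" "L sums S'"
    and lim: "\<And>k. (\<lambda>n. A n k) \<longlonglongrightarrow> L k" "S \<longlonglongrightarrow> S'"
    and B: "\<And>n k. \<bar>B n k\<bar> \<le> 1" "\<And>k. (\<lambda>n. B n k) \<longlonglongrightarrow> C k"
  shows "(\<lambda>n. \<Sum>k. A n k * B n k) \<longlonglongrightarrow> (\<Sum>k. L k * C k)"
proof -
  let ?M = "count_space (UNIV :: nat set)"
  have l1: "integrable ?M f \<and> (\<integral>\<^sup>+ k. norm (f k) \<partial>?M) = ennreal T"
    if "\<And>k. 0 \<le> f k" "f sums T" for f :: "nat \<Rightarrow> real" and T
  proof -
    have i: "integrable ?M f"
      unfolding integrable_count_space_nat_iff using sums_summable[OF that(2)] that(1) by simp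
    have "(\<integral>\<^sup>+ k. norm (f k) \<partial>?M) = ennreal (\<integral>k. f k \<partial>?M)"
      using nn_integral_eq_integral[OF i] that(1) by simp
    also have "(\<integral>k. f k \<partial>?M) = T"
      using sums_integral_count_space_nat[OF i] that(2) sums_unique2 by blast
    finally show ?thesis using i by blast
  qed
  have iA: "integrable ?M (A n)" and nA: "(\<integral>\<^sup>+ k. norm (A n k) \<partial>?M) = ennreal (S n)" for n
    using l1[of "A n", OF A(1) A(2)] by blast+
  have iL: "integrable ?M L" and nL: "(\<integral>\<^sup>+ k. norm (L k) \<partial>?M) = ennreal S'"
    using l1[of L, OF A(3) A(4)] by blast+
  have "(\<lambda>n. \<integral>\<^sup>+ k. norm (A n k - L k) \<partial>?M) \<longlonglongrightarrow> 0"
  proof (rule Scheffe_lemma1[OF iA iL])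
    have "(\<lambda>n. ennreal (S n)) \<longlonglongrightarrow> ennreal S'" using lim(2) by (rule tendsto_ennrealI)
    then have "limsup (\<lambda>n. ennreal (S n)) = ennreal S'" by (rule lim_imp_Limsup[rotated]) simp
    then show "limsup (\<lambda>n. \<integral>\<^sup>+ k. norm (A n k) \<partial>?M) \<le> (\<integral>\<^sup>+ k. norm (L k) \<partial>?M)"
      unfolding nA nL by simp
  qed (use lim in auto)
  moreover have iD: "integrable ?M (\<lambda>k. \<bar>A n k - L k\<bar>)" for n
    by (intro integrable_abs Bochner_Integration.integrable_diff iA iL)
  then have eD: "(\<integral>\<^sup>+ k. norm (A n k - L k) \<partial>?M) = ennreal (\<integral>k. \<bar>A n k - L k\<bar> \<partial>?M)" for n
    using nn_integral_eq_integral[OF iD[of n]] by simp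
  ultimately have "(\<lambda>n. ennreal (\<integral>k. \<bar>A n k - L k\<bar> \<partial>?M)) \<longlonglongrightarrow> ennreal 0" by simp
  then have D0: "(\<lambda>n. \<integral>k. \<bar>A n k - L k\<bar> \<partial>?M) \<longlonglongrightarrow> 0"
    using tendsto_ennreal_iff[of "\<lambda>n. \<integral>k. \<bar>A n k - L k\<bar> \<partial>?M" sequentially 0] by simp
  have iAB: "integrable ?M (\<lambda>k. A n k * B n k)" for n
    by (rule Bochner_Integration.integrable_bound[OF iA[of n]])
      (simp_all add: abs_mult mult_left_le B(1))
  have iLB: "integrable ?M (\<lambda>k. L k * B n k)" for n
    by (rule Bochner_Integration.integrable_bound[OF iL])
      (simp_all add: abs_mult mult_left_le B(1))
  have C1: "\<bar>C k\<bar> \<le> 1" for k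
    by (rule tendsto_upperbound[OF tendsto_rabs[OF B(2)]]) (auto simp: B(1))
  have iLC: "integrable ?M (\<lambda>k. L k * C k)"
    by (rule Bochner_Integration.integrable_bound[OF iL])
      (simp_all add: abs_mult mult_left_le C1)
  have "(\<lambda>n. \<integral>k. L k * B n k \<partial>?M) \<longlonglongrightarrow> (\<integral>k. L k * C k \<partial>?M)"
  proof (rule integral_dominated_convergence[where w = L])
    show "AE k in ?M. (\<lambda>n. L k * B n k) \<longlonglongrightarrow> L k * C k"
      by (intro AE_I2 tendsto_mult tendsto_const B)
    show "AE k in ?M. norm (L k * B n k) \<le> L k" for n
      by (intro AE_I2) (simp add: abs_mult A(3) mult_left_le B(1))
  qed (use iL in simp_all)
  moreover have "(\<lambda>n. \<integral>k. (A n k - L k) * B n k \<partial>?M) \<longlonglongrightarrow> 0"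
  proof (rule Lim_null_comparison[OF _ D0])
    have "norm (\<integral>k. (A n k - L k) * B n k \<partial>?M) \<le> (\<integral>k. \<bar>A n k - L k\<bar> \<partial>?M)" for n
    proof -
      have i: "integrable ?M (\<lambda>k. (A n k - L k) * B n k)"
        unfolding left_diff_distrib by (rule Bochner_Integration.integrable_diff[OF iAB iLB])
      have "norm (\<integral>k. (A n k - L k) * B n k \<partial>?M) \<le> (\<integral>k. norm ((A n k - L k) * B n k) \<partial>?M)"
        by (rule integral_norm_bound)
      also have "\<dots> \<le> (\<integral>k. \<bar>A n k - L k\<bar> \<partial>?M)"
      proof (rule integral_mono[OF integrable_norm[OF i] iD])
        show "norm ((A n k - L k) * B n k) \<le> \<bar>A n k - L k\<bar>" for k
          using mult_left_le[OF B(1)[of n k], of "\<bar>A n k - L k\<bar>"] by (simp add: abs_mult)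
      qed
      finally show ?thesis .
    qed
    then show "\<forall>\<^sub>F n in sequentially. norm (\<integral>k. (A n k - L k) * B n k \<partial>?M) \<le> (\<integral>k. \<bar>A n k - L k\<bar> \<partial>?M)"
      by (rule always_eventually[OF allI])
  qed
  ultimately have "(\<lambda>n. (\<integral>k. (A n k - L k) * B n k \<partial>?M) + (\<integral>k. L k * B n k \<partial>?M)) \<longlonglongrightarrow> 0 + (\<integral>k. L k * C k \<partial>?M)"
    by (intro tendsto_add)
  moreover have "(\<integral>k. (A n k - L k) * B n k \<partial>?M) + (\<integral>k. L k * B n k \<partial>?M) = (\<Sum>k. A n k * B n k)" for n
    unfolding left_diff_distrib Bochner_Integration.integral_diff[OF iAB iLB]
    using sums_unique[OF sums_integral_count_space_nat[OF iAB[of n]]] by linarith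
  moreover have "(\<integral>k. L k * C k \<partial>?M) = (\<Sum>k. L k * C k)"
    using sums_unique[OF sums_integral_count_space_nat[OF iLC]] by simp
  ultimately show ?thesis by simp
qed

text \<open>
  The slopes of the generating function between \<open>x n\<close> and \<open>1\<close> are the expectations of
  \<open>\<Sum>i<k. x n ^ i\<close>, which increase to \<open>k\<close>. By monotone convergence their limit is the mean, and
  integrability need not be known beforehand.
\<close>
lemma
  fixes N :: "nat pmf" and x :: "nat \<Rightarrow> real"
  assumes x: "incseq x" "\<And>n. 0 \<le> x n" "\<And>n. x n < 1" "x \<longlonglongrightarrow> 1"
    and lim: "(\<lambda>n. (1 - pgf N (x n)) / (1 - x n)) \<longlonglongrightarrow> m"
  shows integrable_pmf_if_pgf_derivative: "integrable (measure_pmf N) real"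
    and expectation_pmf_if_pgf_derivative: "measure_pmf.expectation N real = m"
proof -
  define f where "f n k = (1 - x n ^ k) / (1 - x n)" for n k
  have f_sum: "f n k = (\<Sum>i<k. x n ^ i)" for n k
    using x(3)[of n] by (simp add: f_def one_diff_power_eq)
  have i: "integrable (measure_pmf N) (f n)" for n
    unfolding f_def using integrable_pgf[of "x n" N] x(2,3)[of n] by simp
  have mono: "AE k in measure_pmf N. mono (\<lambda>n. f n k)"
    unfolding f_sum using x(1,2) by (intro AE_I2 monoI sum_mono power_mono) (auto dest: incseqD)
  have "(\<lambda>n. f n k) \<longlonglongrightarrow> (\<Sum>i<k. 1 ^ i)" for k
    unfolding f_sum by (intro tendsto_intros x(4))
  then have l: "AE k in measure_pmf N. (\<lambda>n. f n k) \<longlonglongrightarrow> real k" by simp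
  have "measure_pmf.expectation N (f n) = (1 - pgf N (x n)) / (1 - x n)" for n
    unfolding f_def pgf_def using integrable_pgf[of "x n" N] x(2,3)[of n] by simp
  with lim have il: "(\<lambda>n. measure_pmf.expectation N (f n)) \<longlonglongrightarrow> m" by simp
  show "integrable (measure_pmf N) real"
    by (rule integrable_monotone_convergence[OF i mono l il]) simp
  show "measure_pmf.expectation N real = m"
    by (rule integral_monotone_convergence[OF i mono l il]) simp
qed

section \<open>The backward equation\<close>

lemma filterlim_one_over_Suc: "filterlim (\<lambda>n. 1 / real (Suc n)) (at_right 0) sequentially"
  unfolding filterlim_at by (auto intro: LIMSEQ_Suc lim_1_over_n simp del: of_nat_Suc)

text \<open>
  Rates are used along the steps \<open>1 / Suc n\<close>, because convergence theorems for integrals and sums concern sequences.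
\<close>
lemma tendsto_rate_one_over_Suc:
  fixes f :: "real \<Rightarrow> real"
  assumes "(\<lambda>d. f d - c * d) \<in> o[at_right 0](\<lambda>d. d)"
  shows "(\<lambda>n. f (1 / Suc n) * Suc n) \<longlonglongrightarrow> c"
proof -
  have *: "(y - c * (1 / N)) / (1 / N) = y * N - c" if "N \<noteq> 0" for y N :: real
    using that by (simp add: field_simps)
  have "((\<lambda>d. (f d - c * d) / d) \<longlongrightarrow> 0) (at_right 0)"
    using assms by (rule smalloD_tendsto)
  from filterlim_compose[OF this filterlim_one_over_Suc]
  have "(\<lambda>n. f (1 / Suc n) * Suc n - c) \<longlonglongrightarrow> 0"
    by (subst (asm) *) simp_all
  then show ?thesis by (rule LIM_zero_cancel)
qed

context markov_branching_transitions
begin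

lemma pgf_branching:
  assumes "0 \<le> s" "s \<le> t" "0 \<le> x" "x \<le> 1"
  shows "pgf (P s t i) x = pgf (P s t 1) x ^ i"
proof (induction i)
  case 0
  then show ?case using branching_zero[OF assms(1,2)] by simp
next
  case (Suc i)
  have "P s t (Suc i) = map_pmf (\<lambda>(x, y). x + y) (pair_pmf (P s t i) (P s t 1))"
    using branching_add[OF assms(1,2), of i 1] by simp
  then show ?case using Suc assms by (simp add: pgf_convolution)
qed

lemma pgf_flow:
  assumes "0 \<le> s" "s \<le> t" "t \<le> u" "0 \<le> x" "x \<le> 1"
  shows "pgf (P s u 1) x = pgf (P s t 1) (pgf (P t u 1) x)"
  unfolding chapman_kolmogorov[OF assms(1-3)]
proof (rule pgf_bind)
  show "pgf (P t u j) x = pgf (P t u 1) x ^ j" for j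
    by (rule pgf_branching) (use assms in auto)
qed (use assms in \<open>auto simp: pgf_nonneg pgf_le_1\<close>)

text \<open>
  Continuing the generating function by its terminal value \<open>x\<close> beyond \<open>t\<close> makes difference quotients
  meaningful up to the right end point of \<open>[0, t]\<close>.
\<close>
definition backward_pgf :: "real \<Rightarrow> real \<Rightarrow> real \<Rightarrow> real" where
  "backward_pgf t x s = (if s \<le> t then pgf (P s t 1) x else x)"

lemma backward_pgf_bounds:
  assumes "0 \<le> x" "x \<le> 1"
  shows "0 \<le> backward_pgf t x s" "backward_pgf t x s \<le> 1"
  using assms by (auto simp: backward_pgf_def pgf_nonneg pgf_le_1)

lemma backward_pgf_terminal: "0 \<le> t \<Longrightarrow> backward_pgf t x t = x"
  by (simp add: backward_pgf_def initial)

lemma backward_pgf_flow: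
  assumes "0 \<le> s" "s \<le> r" "r \<le> t" "0 \<le> x" "x \<le> 1"
  shows "backward_pgf t x s = pgf (P s r 1) (backward_pgf t x r)"
  using pgf_flow[OF assms] assms by (simp add: backward_pgf_def)

lemma one_minus_stay_le:
  assumes "0 \<le> s" "s \<le> t"
  shows "1 - pmf (P s t 1) 1 \<le> (LBINT u:{s..t}. lam u)"
  using survival[OF assms] exp_ge_add_one_self[of "- (LBINT u:{s..t}. lam u)"] by linarith

text \<open>
  An individual survives unchanged up to time \<open>t\<close> with positive probability, so the generating function stays
  below \<open>1\<close>. This keeps \<open>1 - F\<close> positive, as needed for its negative powers.
\<close>
lemma backward_pgf_lt_1:
  assumes "0 \<le> s" "0 \<le> x" "x < 1"
  shows "backward_pgf t x s < 1"
proof (cases "s \<le> t")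
  case True
  have "0 < pmf (P s t 1) 1" using survival[OF assms(1) True] exp_gt_zero less_le_trans by blast
  then have "0 < pmf (P s t 1) 1 * (1 - x)" using assms by simp
  then show ?thesis using pgf_le_linear[of x "P s t 1"] assms True by (simp add: backward_pgf_def)
qed (use assms in \<open>simp add: backward_pgf_def\<close>)

lemma backward_pgf_increment:
  assumes lam: "\<And>t. 0 \<le> t \<Longrightarrow> 0 \<le> lam t" "\<And>t. 0 \<le> t \<Longrightarrow> set_integrable lborel {0..t} lam"
    and "0 \<le> s" "s \<le> r" "0 \<le> x" "x \<le> 1" "0 \<le> t"
  shows "\<bar>backward_pgf t x r - backward_pgf t x s\<bar> \<le> (LBINT u:{s..r}. lam u)"
proof -
  have *: "\<bar>backward_pgf t x r - backward_pgf t x s\<bar> \<le> (LBINT u:{s..r}. lam u)" if "0 \<le> s" "s \<le> r" "r \<le> t" for s r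
  proof -
    have "\<bar>backward_pgf t x r - backward_pgf t x s\<bar> \<le> 1 - pmf (P s r 1) 1"
      unfolding backward_pgf_flow[OF that assms(5,6)] abs_minus_commute[of "backward_pgf t x r"]
      by (rule abs_pgf_minus_id_le) (use backward_pgf_bounds assms in auto)
    then show ?thesis using one_minus_stay_le[OF that(1,2)] by linarith
  qed
  have pos: "0 \<le> (LBINT u:{a..b}. lam u)" if "0 \<le> a" for a b
    by (rule set_integral_Icc_nonneg) (use that lam in auto)
  consider "r \<le> t" | "s \<le> t" "t < r" | "t < s" by linarith
  then show ?thesis
  proof cases
    case 1 then show ?thesis using * assms by blast
  next
    case 2
    have "set_integrable lborel {s..r} lam"
      by (rule set_integrable_subset[OF lam(2)[of r]]) (use assms in auto)
    then have "(LBINT u:{s..t}. lam u) \<le> (LBINT u:{s..r}. lam u)"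
      using set_integral_Icc_combine[of s t r lam] 2 pos[of t r] assms by simp
    moreover have "backward_pgf t x r = backward_pgf t x t" using 2 assms by (simp add: backward_pgf_terminal) (simp add: backward_pgf_def)
    ultimately show ?thesis using *[of s t] 2 assms by simp
  next
    case 3 then show ?thesis using pos[of s r] assms by (simp add: backward_pgf_def)
  qed
qed

lemma continuous_on_backward_pgf:
  assumes lam: "\<And>t. 0 \<le> t \<Longrightarrow> 0 \<le> lam t" "\<And>t. 0 \<le> t \<Longrightarrow> set_integrable lborel {0..t} lam"
    and "0 \<le> x" "x \<le> 1" "0 \<le> t" "0 \<le> a"
  shows "continuous_on {a..b} (backward_pgf t x)"
proof -
  define \<Lambda> where "\<Lambda> s = (LBINT u:{0..s}. lam u)" for s
  have "continuous_on {0..max 0 b} \<Lambda>"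
    by (rule continuous_on_indefinite_integral[OF lam(2), where c = 0]) (auto simp: \<Lambda>_def)
  then have c: "continuous_on {a..b} \<Lambda>" by (rule continuous_on_subset) (use assms in auto)
  have inc: "\<bar>backward_pgf t x r - backward_pgf t x s\<bar> \<le> \<bar>\<Lambda> r - \<Lambda> s\<bar>" if "0 \<le> s" "s \<le> r" for s r
    using backward_pgf_increment[OF lam that assms(3-5)] set_integral_Icc_combine[of 0 s r lam] that lam(2)[of r]
    by (simp add: \<Lambda>_def)
  have inc': "\<bar>backward_pgf t x r - backward_pgf t x s\<bar> \<le> \<bar>\<Lambda> r - \<Lambda> s\<bar>" if "0 \<le> s" "0 \<le> r" for s r
    using inc[of s r] inc[of r s] that by (cases "s \<le> r") (auto simp: abs_minus_commute)
  show ?thesis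
    unfolding continuous_on_iff dist_real_def
  proof (intro ballI allI impI)
    fix s e :: real assume s: "s \<in> {a..b}" and e: "0 < e"
    obtain d where d: "d > 0" "\<And>r. r \<in> {a..b} \<Longrightarrow> \<bar>r - s\<bar> < d \<Longrightarrow> \<bar>\<Lambda> r - \<Lambda> s\<bar> < e"
      using c s e unfolding continuous_on_iff dist_real_def by blast
    have "\<bar>backward_pgf t x r - backward_pgf t x s\<bar> < e" if "r \<in> {a..b}" "\<bar>r - s\<bar> < d" for r
      using inc'[of s r] d(2)[OF that] s that(1) assms(6) by simp
    with d(1) show "\<exists>d>0. \<forall>r\<in>{a..b}. \<bar>r - s\<bar> < d \<longrightarrow> \<bar>backward_pgf t x r - backward_pgf t x s\<bar> < e"
      by blast
  qed
qed

lemma AE_stay_rate: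
  "AE s in lborel. 0 \<le> s \<longrightarrow> (\<lambda>n. (1 - pmf (P s (s + 1 / Suc n) 1) 1) * Suc n) \<longlonglongrightarrow> lam s"
  using death_rate
proof eventually_elim
  case (elim s)
  show ?case
    by (intro impI tendsto_rate_one_over_Suc[of "\<lambda>d. 1 - pmf (P s (s + d) 1) 1"]) (rule elim[rule_format])
qed

lemma AE_replacement_rate:
  "AE s in lborel. 0 \<le> s \<longrightarrow> (\<forall>k. k \<noteq> 1 \<longrightarrow>
     (\<lambda>n. pmf (P s (s + 1 / Suc n) 1) k * Suc n) \<longlonglongrightarrow> lam s * pmf (p s) k)"
  using replacement_rate
proof eventually_elim
  case (elim s)
  show ?case
    by (intro impI allI tendsto_rate_one_over_Suc[of "\<lambda>d. pmf (P s (s + d) 1) _"]) (rule elim[rule_format])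
qed

text \<open>
  With \<open>y n\<close> the value at time \<open>s + 1 / Suc n\<close>, the flow property turns the increment into
  \<open>pgf N (y n) - y n\<close> for the transition law \<open>N\<close> over the short interval. Its rescaled power series
  converges termwise, and \<open>tendsto_suminf_mult_Scheffe\<close> exchanges limit and sum although \<open>y n\<close> moves.
\<close>
lemma AE_backward_pgf_derivative:
  assumes lam: "\<And>t. 0 \<le> t \<Longrightarrow> 0 \<le> lam t" "\<And>t. 0 \<le> t \<Longrightarrow> set_integrable lborel {0..t} lam"
    and p1: "\<And>t. 0 \<le> t \<Longrightarrow> pmf (p t) 1 = 0"
    and "0 \<le> x" "x \<le> 1" "0 \<le> t"
  shows "AE s in lborel. 0 \<le> s \<and> s < t \<longrightarrow>
     (\<lambda>n. (backward_pgf t x s - backward_pgf t x (s + 1 / Suc n)) * Suc n) \<longlonglongrightarrow> lam s * (pgf (p s) (backward_pgf t x s) - backward_pgf t x s)"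
  using AE_stay_rate AE_replacement_rate
proof eventually_elim
  case (elim s)
  show ?case
  proof
    assume s: "0 \<le> s \<and> s < t"
    define N where "N n = P s (s + 1 / Suc n) 1" for n
    define y where "y n = backward_pgf t x (s + 1 / Suc n)" for n
    define q where "q M k = (if k = 1 then 0 else pmf M k)" for M :: "nat pmf" and k
    have yb: "0 \<le> y n" "y n \<le> 1" for n unfolding y_def using backward_pgf_bounds assms by blast+
    have ylim: "y \<longlonglongrightarrow> backward_pgf t x s"
    proof -
      have l: "(\<lambda>n. s + 1 / real (Suc n)) \<longlonglongrightarrow> s + 0"
        by (intro tendsto_intros LIMSEQ_Suc lim_1_over_n)
      have c: "continuous_on {s..s + 1} (backward_pgf t x)" by (rule continuous_on_backward_pgf) (use assms s in auto)
      show ?thesis unfolding y_def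
        by (rule continuous_on_tendsto_compose[OF c]) (use l in auto)
    qed
    have "(\<lambda>n. \<Sum>k. (q (N n) k * Suc n) * (y n ^ k - y n))
        \<longlonglongrightarrow> (\<Sum>k. (q (p s) k * lam s) * (backward_pgf t x s ^ k - backward_pgf t x s))"
    proof (rule tendsto_suminf_mult_Scheffe)
      show "(\<lambda>k. q (N n) k * Suc n) sums ((1 - pmf (N n) 1) * Suc n)" for n
        unfolding q_def by (intro sums_mult2 pmf_not_1_sums)
      show "(\<lambda>k. q (p s) k * lam s) sums ((1 - pmf (p s) 1) * lam s)"
        unfolding q_def by (intro sums_mult2 pmf_not_1_sums)
      show "(\<lambda>n. (1 - pmf (N n) 1) * Suc n) \<longlonglongrightarrow> (1 - pmf (p s) 1) * lam s"
        using elim(1) s p1 by (simp add: N_def)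
      show "(\<lambda>n. q (N n) k * Suc n) \<longlonglongrightarrow> q (p s) k * lam s" for k
        using elim(2) s by (auto simp: q_def N_def mult.commute[of _ "lam s"])
      show "\<bar>y n ^ k - y n\<bar> \<le> 1" for n k using abs_power_minus_id_le_1 yb by blast
      show "(\<lambda>n. y n ^ k - y n) \<longlonglongrightarrow> backward_pgf t x s ^ k - backward_pgf t x s" for k
        by (intro tendsto_intros ylim)
    qed (use lam s in \<open>auto simp: q_def\<close>)
    also have "(\<Sum>k. (q (p s) k * lam s) * (backward_pgf t x s ^ k - backward_pgf t x s)) = lam s * (pgf (p s) (backward_pgf t x s) - backward_pgf t x s)"
      using sums_mult[OF pgf_minus_id_sums[of "backward_pgf t x s" "p s"], of "lam s"] backward_pgf_bounds[OF assms(4,5), of t s]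
      by (simp add: q_def sums_iff mult_ac)
    also have "(\<lambda>n. \<Sum>k. (q (N n) k * Suc n) * (y n ^ k - y n)) = (\<lambda>n. (pgf (N n) (y n) - y n) * Suc n)"
    proof
      fix n
      show "(\<Sum>k. (q (N n) k * Suc n) * (y n ^ k - y n)) = (pgf (N n) (y n) - y n) * Suc n"
        using sums_mult2[OF pgf_minus_id_sums[OF yb[of n], of "N n"], of "real (Suc n)"]
        by (simp add: q_def sums_iff mult_ac)
    qed
    finally have lim: "(\<lambda>n. (pgf (N n) (y n) - y n) * Suc n) \<longlonglongrightarrow> lam s * (pgf (p s) (backward_pgf t x s) - backward_pgf t x s)" .
    have "\<forall>\<^sub>F n in sequentially. 1 / real (Suc n) < t - s"
      by (rule order_tendstoD(2)[OF LIMSEQ_Suc[OF lim_1_over_n]]) (use s in auto)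
    then have "\<forall>\<^sub>F n in sequentially. (pgf (N n) (y n) - y n) * Suc n = (backward_pgf t x s - y n) * Suc n"
    proof eventually_elim
      case (elim n)
      then have "backward_pgf t x s = pgf (N n) (y n)"
        unfolding N_def y_def by (intro backward_pgf_flow) (use s assms in \<open>auto simp del: of_nat_Suc\<close>)
      then show ?case by simp
    qed
    from Lim_transform_eventually[OF lim this]
    show "(\<lambda>n. (backward_pgf t x s - backward_pgf t x (s + 1 / Suc n)) * Suc n) \<longlonglongrightarrow> lam s * (pgf (p s) (backward_pgf t x s) - backward_pgf t x s)"
      by (simp add: y_def)
  qed
qed

text \<open>
  Both \<open>\<Lambda> + F\<close> and \<open>\<Lambda> - F\<close> are nondecreasing, and their difference quotients are asymptotically at
  least \<open>lam + F'\<close> and \<open>lam - F'\<close>. The two resulting inequalities enclose the increment of \<open>F\<close>,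
  because the increment of \<open>\<Lambda>\<close> is exactly the integral of \<open>lam\<close>.
\<close>
lemma backward_equation:
  assumes lam: "\<And>t. 0 \<le> t \<Longrightarrow> 0 \<le> lam t" "\<And>t. 0 \<le> t \<Longrightarrow> set_integrable lborel {0..t} lam"
    and p1: "\<And>t. 0 \<le> t \<Longrightarrow> pmf (p t) 1 = 0"
    and x: "0 \<le> x" "x \<le> 1" and a: "0 \<le> a" "a \<le> b" "b \<le> t"
    and int: "set_integrable lborel {a..b} (\<lambda>s. lam s * (pgf (p s) (backward_pgf t x s) - backward_pgf t x s))"
  shows "backward_pgf t x a = backward_pgf t x b + (LBINT s:{a..b}. lam s * (pgf (p s) (backward_pgf t x s) - backward_pgf t x s))"
proof -
  define g where "g s = lam s * (pgf (p s) (backward_pgf t x s) - backward_pgf t x s)" for s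
  define \<Lambda> where "\<Lambda> s = (LBINT u:{0..s}. lam u)" for s
  have t: "0 \<le> t" using a by simp
  have lamab: "set_integrable lborel {a..b} lam" by (rule set_integrable_subset[OF lam(2)[of b]]) (use a in auto)
  have \<Lambda>inc: "\<Lambda> r - \<Lambda> s = (LBINT u:{s..r}. lam u)" if "0 \<le> s" "s \<le> r" for s r
    using set_integral_Icc_combine[of 0 s r lam] that lam(2)[of r] by (simp add: \<Lambda>_def)
  have c\<Lambda>: "continuous_on {a..b + 1} \<Lambda>"
  proof (rule continuous_on_subset)
    show "continuous_on {0..b + 1} \<Lambda>"
      by (rule continuous_on_indefinite_integral[OF lam(2), where c = 0]) (use a in \<open>auto simp: \<Lambda>_def\<close>)
  qed (use a in auto)
  have cb: "continuous_on {a..b + 1} (backward_pgf t x)" by (rule continuous_on_backward_pgf) (use lam x t a in auto)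
  have binc: "\<bar>backward_pgf t x r - backward_pgf t x s\<bar> \<le> \<Lambda> r - \<Lambda> s" if "0 \<le> s" "s \<le> r" for s r
    using backward_pgf_increment[OF lam that x t] \<Lambda>inc[OF that] by simp
  have gb: "\<bar>g s\<bar> \<le> lam s" if "0 \<le> s" for s
  proof -
    have "\<bar>pgf (p s) (backward_pgf t x s) - backward_pgf t x s\<bar> \<le> 1"
      using abs_pgf_minus_id_le[of "backward_pgf t x s" "p s"] backward_pgf_bounds[OF x] p1[OF that] by simp
    then show ?thesis using lam(1)[OF that] unfolding g_def by (simp add: abs_mult mult_left_le)
  qed
  \<comment> \<open>One-sided information suffices: the survival condition bounds the death probability by the increment of \<open>\<Lambda>\<close>.\<close>
  have \<Lambda>rate: "AE s in lborel. 0 \<le> s \<longrightarrow> (\<forall>e>0. \<forall>\<^sub>F n in sequentially. lam s - e \<le> (\<Lambda> (s + 1 / Suc n) - \<Lambda> s) * Suc n)"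
    using AE_stay_rate
  proof eventually_elim
    case (elim s)
    show ?case
    proof (intro impI allI)
      fix e :: real assume "0 \<le> s" "0 < e"
      then have "\<forall>\<^sub>F n in sequentially. lam s - e < (1 - pmf (P s (s + 1 / Suc n) 1) 1) * Suc n"
        using elim by (intro order_tendstoD(1)) auto
      then show "\<forall>\<^sub>F n in sequentially. lam s - e \<le> (\<Lambda> (s + 1 / Suc n) - \<Lambda> s) * Suc n"
      proof eventually_elim
        case (elim n)
        have "(1 - pmf (P s (s + 1 / Suc n) 1) 1) * Suc n \<le> (\<Lambda> (s + 1 / Suc n) - \<Lambda> s) * Suc n"
          using one_minus_stay_le[of s "s + 1 / Suc n"] \<Lambda>inc[of s "s + 1 / Suc n"] \<open>0 \<le> s\<close>
          by (intro mult_right_mono) (auto simp del: of_nat_Suc)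
        with elim show ?case by linarith
      qed
    qed
  qed
  have der: "AE s in lborel. 0 \<le> s \<and> s < t \<longrightarrow>
     (\<lambda>n. (backward_pgf t x s - backward_pgf t x (s + 1 / Suc n)) * Suc n) \<longlonglongrightarrow> g s"
    unfolding g_def by (rule AE_backward_pgf_derivative) (use lam p1 x t in auto)
  \<comment> \<open>The sign \<open>c\<close> treats \<open>\<Lambda> + F\<close> and \<open>\<Lambda> - F\<close> at once; \<open>- g\<close> is the derivative of \<open>F\<close>.\<close>
  have key: "(LBINT s:{a..b}. lam s - c * g s) \<le> (\<Lambda> b + c * backward_pgf t x b) - (\<Lambda> a + c * backward_pgf t x a)"
    if c: "c = 1 \<or> c = -1" for c
  proof (rule integral_le_increment_if_mono)
    show "a \<le> b" by fact
    show "\<Lambda> s + c * backward_pgf t x s \<le> \<Lambda> r + c * backward_pgf t x r" if "a \<le> s" "s \<le> r" for s r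
      using binc[of s r] that a c by auto
    show "continuous_on {a..b + 1} (\<lambda>s. \<Lambda> s + c * backward_pgf t x s)" by (intro continuous_intros c\<Lambda> cb)
    show "set_integrable lborel {a..b} (\<lambda>s. lam s - c * g s)"
      using lamab int unfolding g_def by (intro set_integral_diff(1) set_integrable_mult_right) auto
    show "0 \<le> lam s - c * g s" if "s \<in> {a..b}" for s using gb[of s] that a c by auto
    show "AE s in lborel. s \<in> {a..<b} \<longrightarrow> (\<forall>e>0. \<forall>\<^sub>F n in sequentially.
      lam s - c * g s - e \<le> (\<Lambda> (s + 1 / Suc n) + c * backward_pgf t x (s + 1 / Suc n) - (\<Lambda> s + c * backward_pgf t x s)) * Suc n)"
      using \<Lambda>rate der
    proof eventually_elim
      case (elim s)
      show ?case
      proof (intro impI allI)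
        fix e :: real assume s: "s \<in> {a..<b}" and e: "0 < e"
        have 1: "\<forall>\<^sub>F n in sequentially. lam s - e/2 \<le> (\<Lambda> (s + 1 / Suc n) - \<Lambda> s) * Suc n"
          using elim(1) s a e by simp
        have "(\<lambda>n. (backward_pgf t x s - backward_pgf t x (s + 1 / Suc n)) * Suc n) \<longlonglongrightarrow> g s"
          using elim(2) s a by simp
        then have "(\<lambda>n. - c * ((backward_pgf t x s - backward_pgf t x (s + 1 / Suc n)) * Suc n)) \<longlonglongrightarrow> - c * g s"
          by (intro tendsto_intros)
        then have 2: "\<forall>\<^sub>F n in sequentially. - c * g s - e/2 < - c * ((backward_pgf t x s - backward_pgf t x (s + 1 / Suc n)) * Suc n)"
          using e by (intro order_tendstoD(1)) auto
        show "\<forall>\<^sub>F n in sequentially. lam s - c * g s - e \<le>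
          (\<Lambda> (s + 1 / Suc n) + c * backward_pgf t x (s + 1 / Suc n) - (\<Lambda> s + c * backward_pgf t x s)) * Suc n"
          using 1 2
        proof eventually_elim
          case (elim n)
          have "(\<Lambda> (s + 1 / Suc n) + c * backward_pgf t x (s + 1 / Suc n) - (\<Lambda> s + c * backward_pgf t x s)) * Suc n
            = (\<Lambda> (s + 1 / Suc n) - \<Lambda> s) * Suc n + - c * ((backward_pgf t x s - backward_pgf t x (s + 1 / Suc n)) * Suc n)"
            by (simp only: algebra_simps)
          then show ?case using elim by linarith
        qed
      qed
    qed
  qed
  have gi: "set_integrable lborel {a..b} g" using int unfolding g_def[abs_def] .
  have lin: "(LBINT s:{a..b}. lam s - c * g s) = (\<Lambda> b - \<Lambda> a) - c * (LBINT s:{a..b}. g s)" for c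
    using lamab gi \<Lambda>inc[OF a(1,2)] by (simp add: set_integral_diff)
  show ?thesis
    using key[of 1, unfolded lin] key[of "-1", unfolded lin] unfolding g_def[abs_def] by simp
qed

end

section \<open>The theta-positive case\<close>

text \<open>
  The exponent \<open>E\<close> will turn out to be \<open>- \<theta>\<close> times the logarithm of the mean population size, so that
  \<open>exp E\<close> is the weight \<open>\<mu>\<^bsup>-\<theta>\<^esup>\<close> in the definition of \<open>V\<close>.
\<close>
lemma mean_exponent_integral_equation:
  fixes lam a E :: "real \<Rightarrow> real"
  assumes lam: "set_integrable lborel {0..t} lam" and alam: "set_integrable lborel {0..t} (\<lambda>s. a s * lam s)"
    and E: "\<And>r. 0 \<le> r \<Longrightarrow> r \<le> t \<Longrightarrow> E r = \<theta> * (LBINT u:{0..r}. lam u - a u * lam u)"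
    and t: "0 \<le> t"
  shows "continuous_on {0..t} E"
    and "set_integrable lborel {0..t} (\<lambda>s. exp (E s) * lam s)"
    and "set_integrable lborel {0..t} (\<lambda>s. exp (E s) * (a s * lam s))"
    and "exp (E t) = 1 + \<theta> * (LBINT s:{0..t}. exp (E s) * lam s) - \<theta> * (LBINT s:{0..t}. exp (E s) * (a s * lam s))"
proof -
  have E0: "E 0 = 0" using t by (simp add: E set_integral_singleton)
  have Eint: "E r = E 0 + (LBINT s:{0..r}. \<theta> * (lam s - a s * lam s))" if "0 \<le> r" "r \<le> t" for r
    using that by (simp add: E E0)
  have iE: "set_integrable lborel {0..t} (\<lambda>s. lam s - a s * lam s)"
    using lam alam by (rule set_integral_diff(1))
  have iE': "set_integrable lborel {0..t} (\<lambda>s. \<theta> * (lam s - a s * lam s))"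
    by (rule set_integrable_mult_right) (rule iE)
  show cE: "continuous_on {0..t} E" by (rule continuous_on_indefinite_integral[OF iE' Eint])
  then have cexp: "continuous_on {0..t} (\<lambda>s. exp (E s))" by (intro continuous_intros)
  show j1: "set_integrable lborel {0..t} (\<lambda>s. exp (E s) * lam s)"
    by (rule set_integrable_mult_continuous[OF cexp lam])
  show j2: "set_integrable lborel {0..t} (\<lambda>s. exp (E s) * (a s * lam s))"
    by (rule set_integrable_mult_continuous[OF cexp alam])
  have "exp (E t) = exp (E 0) + (LBINT s:{0..t}. exp (E s) * (\<theta> * (lam s - a s * lam s)))"
    by (rule chain_rule_indefinite_integral[where f = E and \<psi> = exp and \<psi>' = exp, OF t iE' Eint])
      (auto intro!: DERIV_exp continuous_intros cE)
  also have "(LBINT s:{0..t}. exp (E s) * (\<theta> * (lam s - a s * lam s)))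
      = (LBINT s:{0..t}. \<theta> * (exp (E s) * lam s) - \<theta> * (exp (E s) * (a s * lam s)))"
    by (simp add: algebra_simps)
  also have "\<dots> = \<theta> * (LBINT s:{0..t}. exp (E s) * lam s) - \<theta> * (LBINT s:{0..t}. exp (E s) * (a s * lam s))"
    using j1 j2 by (simp add: set_integral_diff)
  finally show "exp (E t) = 1 + \<theta> * (LBINT s:{0..t}. exp (E s) * lam s) - \<theta> * (LBINT s:{0..t}. exp (E s) * (a s * lam s))"
    by (simp add: E0)
qed

text \<open>
  The Bernoulli equation is solved with two applications of the chain rule. First,
  \<open>L = E - \<theta> ln G = ln (exp E \<cdot> G\<^bsup>-\<theta>\<^esup>)\<close> has the derivative \<open>v = - \<theta>/(1+\<theta>) G\<^sup>\<theta> a lam\<close>, the linear terms having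
  cancelled. Then \<open>exp L\<close> has the derivative \<open>- \<theta>/(1+\<theta>) exp E a lam\<close>, which no longer contains \<open>G\<close>.
  The integral over \<open>a\<close> is finally expressed by \<open>exp E\<close> and the integral that defines \<open>V\<close>.
\<close>
lemma (in markov_branching_transitions) theta_survival_formula:
  assumes \<theta>: "0 < \<theta>"
    and lam: "\<And>t. 0 \<le> t \<Longrightarrow> 0 \<le> lam t" "\<And>t. 0 \<le> t \<Longrightarrow> set_integrable lborel {0..t} lam"
    and alam: "\<And>t. 0 \<le> t \<Longrightarrow> set_integrable lborel {0..t} (\<lambda>s. a s * lam s)"
    and p1: "\<And>t. 0 \<le> t \<Longrightarrow> pmf (p t) 1 = 0"
    and pgf_p: "\<And>t y. 0 \<le> t \<Longrightarrow> 0 \<le> y \<Longrightarrow> y \<le> 1 \<Longrightarrow> pgf (p t) y = theta_pgf \<theta> (a t) y"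
    and E: "\<And>t. 0 \<le> t \<Longrightarrow> E t = \<theta> * (LBINT u:{0..t}. lam u - a u * lam u)"
    and x: "0 \<le> x" "x < 1" and t: "0 \<le> t"
  shows "(1 - pgf (P 0 t 1) x) powr (- \<theta>) =
    exp (E t) * ((1 - x) powr (- \<theta>) - inverse (1 + \<theta>)) + inverse (1 + \<theta>)
    + \<theta> * inverse (1 + \<theta>) * (LBINT u:{0..t}. exp (E u) * lam u)"
proof -
  define G where "G s = 1 - backward_pgf t x s" for s
  define u where "u s = - lam s * (pgf (p s) (backward_pgf t x s) - backward_pgf t x s)" for s
  have x1: "x \<le> 1" using x by simp
  have Gpos: "0 < G s" if "0 \<le> s" for s using backward_pgf_lt_1[OF that x] by (simp add: G_def)
  have Gne: "G s \<noteq> 0" if "0 \<le> s" for s using Gpos[OF that] by simp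
  have cb: "continuous_on {0..t} (backward_pgf t x)" by (rule continuous_on_backward_pgf) (use lam x t in auto)
  then have cG: "continuous_on {0..t} G" unfolding G_def by (intro continuous_intros)
  have i1: "set_integrable lborel {0..t} lam" and i2: "set_integrable lborel {0..t} (\<lambda>s. a s * lam s)"
    using lam(2) alam t by auto
  have cGp: "continuous_on {0..t} (\<lambda>s. G s powr b)" for b
    by (intro continuous_on_powr cG continuous_intros) (simp add: Gne)
  have u_eq: "u s = - (G s * lam s - G s * (a s * lam s) + (inverse (1 + \<theta>) * G s powr (1 + \<theta>)) * (a s * lam s))"
    if "0 \<le> s" for s
  proof -
    have "pgf (p s) (backward_pgf t x s) - backward_pgf t x s = G s - a s * G s + a s * inverse (1 + \<theta>) * G s powr (1 + \<theta>)"
      using pgf_p[OF that backward_pgf_bounds[OF x(1) x1, of t s]] by (simp add: theta_pgf_def G_def)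
    then show ?thesis unfolding u_def by (simp only:) (simp add: algebra_simps)
  qed
  have iu: "set_integrable lborel {0..t} u"
  proof -
    have "set_integrable lborel {0..t} (\<lambda>s. (-1) * (G s * lam s - G s * (a s * lam s) + (inverse (1 + \<theta>) * G s powr (1 + \<theta>)) * (a s * lam s)))"
      by (rule set_integrable_mult_right, rule set_integral_add(1), rule set_integral_diff(1))
        (rule set_integrable_mult_continuous, (intro continuous_intros cG cGp), rule i1 i2)+
    then show ?thesis by (subst set_integrable_cong[OF refl refl u_eq]) auto
  qed
  have sub: "set_integrable lborel {0..r} f" if "set_integrable lborel {0..t} f" "r \<le> t" for r and f :: "real \<Rightarrow> real"
    by (rule set_integrable_subset[OF that(1)]) (use that in auto)
  have Gint: "G r = G 0 + (LBINT s:{0..r}. - u s)" if "0 \<le> r" "r \<le> t" for r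
  proof -
    have "set_integrable lborel {0..r} (\<lambda>s. (-1) * u s)" by (intro set_integrable_mult_right) (rule sub[OF iu that(2)])
    then have "backward_pgf t x 0 = backward_pgf t x r + (LBINT s:{0..r}. lam s * (pgf (p s) (backward_pgf t x s) - backward_pgf t x s))"
      by (intro backward_equation) (use lam p1 x that in \<open>auto simp: u_def\<close>)
    then show ?thesis by (simp add: G_def u_def)
  qed
  have imu: "set_integrable lborel {0..t} (\<lambda>s. - u s)"
    using set_integrable_mult_right[of "-1" lborel "{0..t}" u] iu by simp
  define L where "L r = E r - \<theta> * ln (G r)" for r
  define c where "c = \<theta> * inverse (1 + \<theta>)"
  define v where "v s = (- c * G s powr \<theta>) * (a s * lam s)" for s
  have iv: "set_integrable lborel {0..t} v"
    unfolding v_def by (rule set_integrable_mult_continuous[OF _ i2]) (intro continuous_intros cGp)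
  have iE: "set_integrable lborel {0..t} (\<lambda>s. lam s - a s * lam s)"
    using i1 i2 by (rule set_integral_diff(1))
  have Lint: "L r = L 0 + (LBINT s:{0..r}. v s)" if r: "0 \<le> r" "r \<le> t" for r
  proof -
    have "ln (G r) = ln (G 0) + (LBINT s:{0..r}. inverse (G s) * - u s)"
    proof (rule chain_rule_indefinite_integral[where f = G and \<psi> = ln and \<psi>' = inverse, OF r(1) sub[OF imu r(2)]])
      show "G s = G 0 + (LBINT x:{0..s}. - u x)" if "0 \<le> s" "s \<le> r" for s
        by (rule Gint) (use that r in auto)
      show "(ln has_real_derivative inverse (G s)) (at (G s))" if "0 \<le> s" "s \<le> r" for s
        using Gpos[OF that(1)] by (rule DERIV_ln)
      show "continuous_on {0..r} (\<lambda>s. inverse (G s))"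
        by (intro continuous_intros continuous_on_subset[OF cG]) (use r Gne in auto)
    qed
    also have "(LBINT s:{0..r}. inverse (G s) * - u s)
      = (LBINT s:{0..r}. (lam s - a s * lam s) + (- inverse \<theta>) * v s)"
    proof (rule set_lebesgue_integral_cong)
      show "\<forall>s. s \<in> {0..r} \<longrightarrow> inverse (G s) * - u s = (lam s - a s * lam s) + (- inverse \<theta>) * v s"
      proof (intro allI impI)
        have *: "i * (- (- (g * l - g * al + (k * (g * y)) * al))) = (l - al) + (- j) * ((- (\<theta> * k) * y) * al)"
          if "i * g = 1" "j * \<theta> = 1" for i j k l al g y :: real
          using that by algebra
        fix s assume "s \<in> {0..r}"
        then have s: "0 \<le> s" by simp
        have "G s powr (1 + \<theta>) = G s * G s powr \<theta>" using Gpos[OF s] by (simp add: powr_add)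
        then show "inverse (G s) * - u s = (lam s - a s * lam s) + (- inverse \<theta>) * v s"
          unfolding u_eq[OF s] v_def c_def by (simp only:) (rule *, use Gne[OF s] \<theta> in simp_all)
      qed
    qed simp
    also have "\<dots> = (LBINT s:{0..r}. lam s - a s * lam s) + (LBINT s:{0..r}. (- inverse \<theta>) * v s)"
      by (intro set_integral_add(2) sub[OF _ r(2)] iE set_integrable_mult_right iv)
    also have "(LBINT s:{0..r}. (- inverse \<theta>) * v s) = (- inverse \<theta>) * (LBINT s:{0..r}. v s)"
      by (rule set_integral_mult_right)
    finally have "ln (G r) = ln (G 0) + ((LBINT s:{0..r}. lam s - a s * lam s) + (- inverse \<theta>) * (LBINT s:{0..r}. v s))" .
    moreover have "E 0 = 0" by (simp add: E set_integral_singleton)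
    ultimately show ?thesis
      unfolding L_def E[OF r(1)] using \<theta> by (simp add: field_simps)
  qed
  have cL: "continuous_on {0..t} L" by (rule continuous_on_indefinite_integral[OF iv Lint])
  have E0: "E 0 = 0" by (simp add: E set_integral_singleton)
  have expL: "exp (L t) = exp (L 0) + (LBINT s:{0..t}. exp (L s) * v s)"
    by (rule chain_rule_indefinite_integral[where f = L and \<psi> = exp and \<psi>' = exp, OF t iv Lint]) (auto intro!: DERIV_exp continuous_intros cL)
  have eL: "exp (L s) = exp (E s) * G s powr (- \<theta>)" if "0 \<le> s" for s
    using Gpos[OF that] by (simp add: L_def powr_def exp_diff exp_minus field_simps)
  define I1 where "I1 = (LBINT s:{0..t}. exp (E s) * lam s)"
  define I2 where "I2 = (LBINT s:{0..t}. exp (E s) * (a s * lam s))"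
  have "(LBINT s:{0..t}. exp (L s) * v s) = (LBINT s:{0..t}. (- c) * (exp (E s) * (a s * lam s)))"
  proof (rule set_lebesgue_integral_cong)
    show "\<forall>s. s \<in> {0..t} \<longrightarrow> exp (L s) * v s = (- c) * (exp (E s) * (a s * lam s))"
    proof (intro allI impI)
      fix s assume "s \<in> {0..t}"
      then have s: "0 \<le> s" by simp
      have "G s powr (- \<theta>) * G s powr \<theta> = 1" using Gne[OF s] by (simp flip: powr_add)
      then show "exp (L s) * v s = (- c) * (exp (E s) * (a s * lam s))"
        unfolding eL[OF s] v_def by (simp add: mult.commute mult.left_commute)
    qed
  qed simp
  also have "\<dots> = - c * I2" unfolding I2_def by (rule set_integral_mult_right)
  finally have A: "exp (L t) = exp (L 0) - c * I2" using expL by simp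
  have B: "exp (E t) = 1 + \<theta> * I1 - \<theta> * I2"
    unfolding I1_def I2_def by (rule mean_exponent_integral_equation(4)) (use i1 i2 E t in auto)
  have Gt: "G t = 1 - x" using backward_pgf_terminal[OF t] by (simp add: G_def)
  have G0: "G 0 = 1 - pgf (P 0 t 1) x" using t by (simp add: G_def backward_pgf_def)
  have "(1 - pgf (P 0 t 1) x) powr (- \<theta>) = exp (E t) * (1 - x) powr (- \<theta>) + c * I2"
    using A eL[of 0] eL[OF t] E0 by (simp add: Gt G0)
  also have "c * I2 = inverse (1 + \<theta>) * (1 + \<theta> * I1 - exp (E t))"
    unfolding B by (simp add: c_def)
  finally show ?thesis by (simp add: I1_def algebra_simps)
qed

lemma one_minus_inverse_Suc_seq:
  defines "x \<equiv> \<lambda>n. 1 - 1 / real (Suc n)"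
  shows "incseq x" "\<And>n. 0 \<le> x n" "\<And>n. x n < 1" "x \<longlonglongrightarrow> 1"
proof -
  show "incseq x"
    unfolding x_def by (intro incseq_SucI diff_mono order_refl divide_left_mono) auto
  show "0 \<le> x n" "x n < 1" for n by (simp_all add: x_def)
  have "x \<longlonglongrightarrow> 1 - 0"
    unfolding x_def by (intro tendsto_intros LIMSEQ_Suc lim_1_over_n)
  then show "x \<longlonglongrightarrow> 1" by simp
qed

lemma powr_minus_inverse_powr:
  fixes y \<theta> :: real
  assumes "0 < \<theta>" "0 < y"
  shows "(y powr (- \<theta>)) powr (- 1 / \<theta>) = y"
  using assms by (simp add: powr_powr)

text \<open>
  Raised to the power \<open>- \<theta>\<close>, the slope is \<open>exp e + k (1 - x)\<^sup>\<theta>\<close>, and the second term vanishes as \<open>x\<close> tends to \<open>1\<close>.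
\<close>
lemma pgf_slope_tendsto_mean:
  fixes N :: "nat pmf" and e k \<theta> :: real
  assumes \<theta>: "0 < \<theta>" and lt1: "\<And>x. 0 \<le> x \<Longrightarrow> x < 1 \<Longrightarrow> pgf N x < 1"
    and formula: "\<And>x. 0 \<le> x \<Longrightarrow> x < 1 \<Longrightarrow> (1 - pgf N x) powr (- \<theta>) = exp e * (1 - x) powr (- \<theta>) + k"
    and x: "\<And>n. 0 \<le> x n" "\<And>n. x n < 1" "x \<longlonglongrightarrow> 1"
  shows "(\<lambda>n. (1 - pgf N (x n)) / (1 - x n)) \<longlonglongrightarrow> exp (- e / \<theta>)"
proof -
  let ?r = "\<lambda>n. (1 - pgf N (x n)) / (1 - x n)"
  have r: "0 < ?r n" for n using lt1[of "x n"] x(1,2)[of n] by simp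
  have *: "?r n powr (- \<theta>) = exp e + k * (1 - x n) powr \<theta>" for n
  proof -
    have "?r n powr (- \<theta>) = (1 - pgf N (x n)) powr (- \<theta>) * (1 - x n) powr \<theta>"
      using lt1[of "x n"] x(1,2)[of n] by (simp add: powr_divide powr_minus field_simps)
    also have "\<dots> = exp e * ((1 - x n) powr (- \<theta>) * (1 - x n) powr \<theta>) + k * (1 - x n) powr \<theta>"
      using formula[of "x n"] x(1,2)[of n] by (simp add: algebra_simps)
    also have "(1 - x n) powr (- \<theta>) * (1 - x n) powr \<theta> = 1"
      using x(2)[of n] by (simp flip: powr_add)
    finally show ?thesis by simp
  qed
  have "(\<lambda>n. 1 - x n) \<longlonglongrightarrow> 1 - 1" by (intro tendsto_intros x(3))
  then have l0: "(\<lambda>n. 1 - x n) \<longlonglongrightarrow> 0" by simp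
  have "\<forall>\<^sub>F n in sequentially. 0 \<le> 1 - x n" using x(2) by (intro always_eventually allI) (simp add: less_imp_le)
  with tendsto_powr2[OF l0 tendsto_const _ \<theta>]
  have "(\<lambda>n. (1 - x n) powr \<theta>) \<longlonglongrightarrow> 0" using \<theta> by simp
  then have "(\<lambda>n. exp e + k * (1 - x n) powr \<theta>) \<longlonglongrightarrow> exp e + k * 0" by (intro tendsto_intros)
  then have "(\<lambda>n. (?r n powr (- \<theta>)) powr (- 1 / \<theta>)) \<longlonglongrightarrow> exp e powr (- 1 / \<theta>)"
    unfolding * by (intro tendsto_intros) auto
  then show ?thesis
    using powr_minus_inverse_powr[OF \<theta> r] by (simp add: powr_def)
qed

section \<open>From transition probabilities to the process\<close>

context markov_branching_process
begin

text \<open>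
  This is the Markov property at time \<open>0\<close>, with the whole sample space as the past event.
\<close>
lemma distr_Z:
  assumes "0 \<le> t"
  shows "distr M (count_space UNIV) (Z t) = measure_pmf (P 0 t 1)"
proof (rule measure_eqI_countable[where A = UNIV])
  have [measurable]: "Z 0 \<in> measurable M (count_space UNIV)" "Z t \<in> measurable M (count_space UNIV)"
    using random_variable_Z assms by auto
  have "prob {\<omega> \<in> space M. Z t \<omega> = j} = pmf (P 0 t 1) j" for j
  proof -
    have sp: "space M \<in> past_events M Z 0" unfolding past_events_def by (rule sigma_sets_top)
    have "prob {\<omega> \<in> space M. Z t \<omega> = j} = prob (space M \<inter> {\<omega> \<in> space M. Z 0 \<omega> = 1 \<and> Z t \<omega> = j})"
      using starts_with_one by (intro finite_measure_eq_AE) auto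
    also have "\<dots> = prob (space M \<inter> {\<omega> \<in> space M. Z 0 \<omega> = 1}) * pmf (P 0 t 1) j"
      by (rule markov[OF order_refl assms sp])
    also have "prob (space M \<inter> {\<omega> \<in> space M. Z 0 \<omega> = 1}) = 1"
      using starts_with_one by (subst prob_eq_1) auto
    finally show ?thesis by simp
  qed
  then have "emeasure (distr M (count_space UNIV) (Z t)) {j} = ennreal (pmf (P 0 t 1) j)" for j
    by (simp add: emeasure_distr vimage_def Int_def conj_commute emeasure_eq_measure)
  then show "emeasure (distr M (count_space UNIV) (Z t)) {j} = emeasure (measure_pmf (P 0 t 1)) {j}" for j
    by (simp add: emeasure_pmf_single)
qed auto

lemma integral_Z:
  fixes f :: "nat \<Rightarrow> real"
  assumes "0 \<le> t"
  shows "(\<integral>\<omega>. f (Z t \<omega>) \<partial>M) = measure_pmf.expectation (P 0 t 1) f"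
    and "integrable M (\<lambda>\<omega>. f (Z t \<omega>)) \<longleftrightarrow> integrable (measure_pmf (P 0 t 1)) f"
  unfolding distr_Z[OF assms, symmetric] using random_variable_Z[OF assms]
  by (simp_all add: integral_distr integrable_distr_eq)

lemma prob_extinct:
  assumes "0 \<le> t"
  shows "prob {\<omega> \<in> space M. Z t \<omega> = 0} = pgf (P 0 t 1) 0"
proof -
  have "prob {\<omega> \<in> space M. Z t \<omega> = 0} = measure (distr M (count_space UNIV) (Z t)) {0}"
    using random_variable_Z[OF assms] by (subst measure_distr) (auto intro!: arg_cong[where f = prob])
  then show ?thesis by (simp add: distr_Z[OF assms] measure_pmf_single pgf_0)
qed

lemma survival_prob_eq_pgf:
  assumes "0 \<le> t"
  shows "survival_prob M Z t = 1 - pgf (P 0 t 1) 0"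
proof -
  have [measurable]: "Z t \<in> measurable M (count_space UNIV)" using random_variable_Z assms by auto
  have "{\<omega> \<in> space M. 0 < Z t \<omega>} = space M - {\<omega> \<in> space M. Z t \<omega> = 0}" by auto
  then show ?thesis
    unfolding survival_prob_def prob_extinct[OF assms, symmetric] by (subst prob_compl[symmetric]) auto
qed

lemma conditional_mean_size_eq:
  assumes t: "0 \<le> t" and int: "integrable M (\<lambda>\<omega>. real (Z t \<omega>))" and pos: "0 < survival_prob M Z t"
  shows "conditional_mean_size M Z t = mean_size M Z t / survival_prob M Z t"
proof -
  have [measurable]: "Z t \<in> measurable M (count_space UNIV)" using random_variable_Z t by auto
  let ?A = "{\<omega> \<in> space M. 0 < Z t \<omega>}"
  have "conditional_mean_size M Z t = enn2real (\<integral>\<^sup>+ \<omega>. ennreal (real (Z t \<omega>)) \<partial>uniform_measure M ?A)"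
    unfolding conditional_mean_size_def by (rule integral_eq_nn_integral) auto
  also have "(\<integral>\<^sup>+ \<omega>. ennreal (real (Z t \<omega>)) \<partial>uniform_measure M ?A)
      = (\<integral>\<^sup>+ \<omega>. ennreal (real (Z t \<omega>)) * indicator ?A \<omega> \<partial>M) / emeasure M ?A"
    by (rule nn_integral_uniform_measure) auto
  also have "(\<integral>\<^sup>+ \<omega>. ennreal (real (Z t \<omega>)) * indicator ?A \<omega> \<partial>M) = (\<integral>\<^sup>+ \<omega>. ennreal (real (Z t \<omega>)) \<partial>M)"
    by (rule nn_integral_cong) (auto simp: indicator_def)
  also have "\<dots> = ennreal (mean_size M Z t)"
    unfolding mean_size_def by (rule nn_integral_eq_integral[OF int]) auto
  also have "emeasure M ?A = ennreal (survival_prob M Z t)"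
    by (simp add: survival_prob_def emeasure_eq_measure)
  also have "ennreal (mean_size M Z t) / ennreal (survival_prob M Z t) = ennreal (mean_size M Z t / survival_prob M Z t)"
    by (rule divide_ennreal[OF _ pos]) (simp add: mean_size_def)
  also have "enn2real \<dots> = mean_size M Z t / survival_prob M Z t"
    using pos by (intro enn2real_ennreal divide_nonneg_pos) (simp_all add: mean_size_def)
  finally show ?thesis .
qed

end

text \<open>
  Everything that the long-time analysis uses about the process. The integrability of the population size is
  part of the argument for the mean, and it is also what makes the conditional mean a quotient.
\<close>
lemma theta_process_closed_form:
  assumes "theta_positive_process M Z \<theta> lam a"
  defines "E \<equiv> \<lambda>t. \<theta> * (LBINT u:{0..t}. lam u - a u * lam u)"
  assumes t: "0 \<le> t"
  shows "mean_size M Z t = exp (- E t / \<theta>)"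
    and "survival_prob M Z t powr (- \<theta>) = inverse (1 + \<theta>) + \<theta> * inverse (1 + \<theta>) * exp (E t)
           + \<theta> * inverse (1 + \<theta>) * (LBINT u:{0..t}. exp (E u) * lam u)"
    and "0 < survival_prob M Z t"
    and "measure M {\<omega> \<in> space M. Z t \<omega> = 0} = 1 - survival_prob M Z t"
    and "conditional_mean_size M Z t = mean_size M Z t / survival_prob M Z t"
    and "set_integrable lborel {0..t} (\<lambda>s. exp (E s) * lam s)"
    and "set_integrable lborel {0..t} (\<lambda>s. exp (E s) * (a s * lam s))"
    and "exp (E t) = 1 + \<theta> * (LBINT s:{0..t}. exp (E s) * lam s) - \<theta> * (LBINT s:{0..t}. exp (E s) * (a s * lam s))"
proof -
  obtain p P where mbp: "markov_branching_process M Z lam p P"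
    and p: "\<And>t. 0 \<le> t \<Longrightarrow> pmf (p t) 1 = 0"
      "\<And>t s. 0 \<le> t \<Longrightarrow> s \<in> {0..1} \<Longrightarrow> (\<lambda>k. pmf (p t) k * s ^ k) sums theta_pgf \<theta> (a t) s"
    using assms(1) unfolding theta_positive_process_def by blast
  interpret markov_branching_process M Z lam p P by (rule mbp)
  have par: "theta_parameters \<theta> lam a" using assms(1) unfolding theta_positive_process_def by blast
  then have \<theta>: "0 < \<theta>" and lam: "\<And>t. 0 \<le> t \<Longrightarrow> 0 \<le> lam t" "\<And>t. 0 \<le> t \<Longrightarrow> set_integrable lborel {0..t} lam"
    and a: "\<And>t. 0 \<le> t \<Longrightarrow> 0 \<le> a t" "\<And>t. 0 \<le> t \<Longrightarrow> a t \<le> 1 + 1 / \<theta>"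
    and meas: "set_borel_measurable borel {0..} lam" "set_borel_measurable borel {0..} a"
    unfolding theta_parameters_def by auto
  have alam: "set_integrable lborel {0..r} (\<lambda>s. a s * lam s)" if r: "0 \<le> r" for r
  proof (rule set_integrable_bound)
    show "set_integrable lborel {0..r} (\<lambda>s. (1 + 1 / \<theta>) * lam s)"
      by (rule set_integrable_mult_right) (rule lam(2)[OF r])
    have "(\<lambda>s. indicator {0..r} s * (indicator {0..} s *\<^sub>R a s) * (indicator {0..} s *\<^sub>R lam s)) \<in> borel_measurable borel"
      using meas unfolding set_borel_measurable_def by (intro borel_measurable_times) auto
    also have "(\<lambda>s. indicator {0..r} s * (indicator {0..} s *\<^sub>R a s) * (indicator {0..} s *\<^sub>R lam s))
       = (\<lambda>s. indicator {0..r} s *\<^sub>R (a s * lam s))" by (auto simp: indicator_def fun_eq_iff)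
    finally show "set_borel_measurable lborel {0..r} (\<lambda>s. a s * lam s)"
      by (simp add: set_borel_measurable_def)
    show "AE s in lborel. s \<in> {0..r} \<longrightarrow> norm (a s * lam s) \<le> norm ((1 + 1 / \<theta>) * lam s)"
    proof (intro AE_I2 impI)
      fix s assume "s \<in> {0..r}"
      then have "0 \<le> a s" "a s \<le> 1 + 1 / \<theta>" "0 \<le> lam s" using a lam(1) by auto
      then have "0 \<le> a s * lam s" "a s * lam s \<le> (1 + 1 / \<theta>) * lam s" by (auto intro: mult_right_mono)
      then show "norm (a s * lam s) \<le> norm ((1 + 1 / \<theta>) * lam s)" by simp
    qed
  qed
  have pgf_p: "pgf (p r) y = theta_pgf \<theta> (a r) y" if "0 \<le> r" "0 \<le> y" "y \<le> 1" for r y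
    using sums_unique2[OF pgf_sums[OF that(2,3)] p(2)[OF that(1)]] that by simp
  define c where "c = inverse (1 + \<theta>)"
  define W where "W = \<theta> * c * (LBINT u:{0..t}. exp (E u) * lam u)"
  have formula: "(1 - pgf (P 0 t 1) x) powr (- \<theta>) = exp (E t) * (1 - x) powr (- \<theta>) + (c + W - c * exp (E t))"
    if "0 \<le> x" "x < 1" for x
  proof -
    have "(1 - pgf (P 0 t 1) x) powr (- \<theta>) = exp (E t) * ((1 - x) powr (- \<theta>) - c) + c + W"
      unfolding W_def c_def
    proof (rule theta_survival_formula[where a = a, OF \<theta>])
      show "E r = \<theta> * (LBINT u:{0..r}. lam u - a u * lam u)" for r by (simp add: E_def)
    qed (use lam alam p pgf_p that t in auto)
    then show ?thesis by (simp add: algebra_simps)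
  qed
  have lt1: "pgf (P 0 t 1) x < 1" if "0 \<le> x" "x < 1" for x
    using backward_pgf_lt_1[of 0 x t] that t by (simp add: backward_pgf_def)
  note slope = pgf_slope_tendsto_mean[OF \<theta> lt1 formula one_minus_inverse_Suc_seq(2-4)]
  have int: "integrable (measure_pmf (P 0 t 1)) real"
    by (rule integrable_pmf_if_pgf_derivative[OF one_minus_inverse_Suc_seq slope])
  have mean: "measure_pmf.expectation (P 0 t 1) real = exp (- E t / \<theta>)"
    by (rule expectation_pmf_if_pgf_derivative[OF one_minus_inverse_Suc_seq slope])
  show "mean_size M Z t = exp (- E t / \<theta>)"
    unfolding mean_size_def using integral_Z(1)[OF t, of real] mean by simp
  have intZ: "integrable M (\<lambda>\<omega>. real (Z t \<omega>))" using integral_Z(2)[OF t, of real] int by simp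
  have surv: "survival_prob M Z t = 1 - pgf (P 0 t 1) 0" by (rule survival_prob_eq_pgf[OF t])
  show pos: "0 < survival_prob M Z t" unfolding surv using lt1[of 0] by simp
  have "1 - c = \<theta> * c" using \<theta> by (simp add: c_def field_simps)
  then have "exp (E t) * 1 - c * exp (E t) = \<theta> * c * exp (E t)"
    by (metis left_diff_distrib mult.commute mult_1)
  then show "survival_prob M Z t powr (- \<theta>) = inverse (1 + \<theta>) + \<theta> * inverse (1 + \<theta>) * exp (E t)
           + \<theta> * inverse (1 + \<theta>) * (LBINT u:{0..t}. exp (E u) * lam u)"
    using formula[of 0] unfolding surv c_def[symmetric] W_def[symmetric] by simp
  show "measure M {\<omega> \<in> space M. Z t \<omega> = 0} = 1 - survival_prob M Z t"
    using prob_extinct[OF t] surv by simp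
  show "conditional_mean_size M Z t = mean_size M Z t / survival_prob M Z t"
    by (rule conditional_mean_size_eq[OF t intZ pos])
  have E: "E r = \<theta> * (LBINT u:{0..r}. lam u - a u * lam u)" for r by (simp add: E_def)
  note eq = mean_exponent_integral_equation[where a = a and E = E and \<theta> = \<theta>, OF lam(2)[OF t] alam[OF t] E t]
  show "set_integrable lborel {0..t} (\<lambda>s. exp (E s) * lam s)" by (rule eq(2))
  show "set_integrable lborel {0..t} (\<lambda>s. exp (E s) * (a s * lam s))" by (rule eq(3))
  show "exp (E t) = 1 + \<theta> * (LBINT s:{0..t}. exp (E s) * lam s) - \<theta> * (LBINT s:{0..t}. exp (E s) * (a s * lam s))"
    by (rule eq(4))
qed

section \<open>Long-time behaviour\<close>

lemma mono_bounded_tendsto_at_top: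
  fixes g :: "real \<Rightarrow> real"
  assumes mono: "\<And>s t. 0 \<le> s \<Longrightarrow> s \<le> t \<Longrightarrow> g s \<le> g t" and bdd: "\<And>t. 0 \<le> t \<Longrightarrow> g t \<le> B"
  obtains l where "(g \<longlongrightarrow> l) at_top"
proof
  have b: "bdd_above (g ` {0..})" using bdd by (auto intro!: bdd_aboveI)
  show "(g \<longlongrightarrow> Sup (g ` {0..})) at_top"
  proof (rule order_tendstoI)
    fix y assume "y < Sup (g ` {0..})"
    then obtain s where s: "0 \<le> s" "y < g s" using less_cSup_iff[OF _ b] by auto
    show "\<forall>\<^sub>F t in at_top. y < g t"
      using eventually_mono[OF eventually_ge_at_top[of s], of "\<lambda>t. y < g t"] less_le_trans[OF s(2) mono[OF s(1)]]
      by blast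
  next
    fix y assume y: "Sup (g ` {0..}) < y"
    show "\<forall>\<^sub>F t in at_top. g t < y"
      using eventually_ge_at_top[of 0]
    proof eventually_elim
      case (elim t)
      then have "g t \<le> Sup (g ` {0..})" by (intro cSup_upper b) simp
      with y show ?case by simp
    qed
  qed
qed

lemma mono_tendsto_or_at_top:
  fixes g :: "real \<Rightarrow> real"
  assumes mono: "\<And>s t. 0 \<le> s \<Longrightarrow> s \<le> t \<Longrightarrow> g s \<le> g t"
  shows "(\<exists>l. (g \<longlongrightarrow> l) at_top) \<or> filterlim g at_top at_top"
proof (cases "\<exists>B. \<forall>t\<ge>0. g t \<le> B")
  case True
  then obtain B where B: "\<forall>t\<ge>0. g t \<le> B" ..
  obtain l where "(g \<longlongrightarrow> l) at_top"
    by (rule mono_bounded_tendsto_at_top[of g B]) (simp_all add: mono B)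
  then show ?thesis by blast
next
  case False
  have "filterlim g at_top at_top"
    unfolding filterlim_at_top
  proof
    fix B
    have "\<not> (\<forall>t\<ge>0. g t \<le> B)" using False by (rule contrapos_nn) (rule exI)
    then obtain s where s: "0 \<le> s" "B < g s" by (auto simp: not_le)
    show "\<forall>\<^sub>F t in at_top. B \<le> g t"
      using eventually_ge_at_top[of s]
    proof eventually_elim
      case (elim t)
      with mono[OF s(1) elim] s(2) show ?case by linarith
    qed
  qed
  then show ?thesis ..
qed

theorem theorem2p1:
  fixes M :: "'w measure"
    and Z :: "real \<Rightarrow> 'w \<Rightarrow> nat"
    and \<theta> :: real
    and lam a :: "real \<Rightarrow> real"
  assumes "theta_positive_process M Z \<theta> lam a"
  shows "(V_lim M Z \<theta> lam < \<infinity> \<longrightarrow>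
           extinction_prob M Z < 1 \<and>
           (\<exists>\<mu>::ereal. ((\<lambda>t. ereal (mean_size M Z t)) \<longlongrightarrow> \<mu>) at_top \<and> 0 < \<mu> \<and>
             extinction_prob M Z =
               1 - (real_of_ereal (V_lim M Z \<theta> lam) + inverse (1 + \<theta>)
                    + \<theta> * inverse (1 + \<theta>)
                      * (if \<mu> = \<infinity> then 0 else real_of_ereal \<mu> powr (- \<theta>)))
                   powr (- 1 / \<theta>)))
       \<and> (V_lim M Z \<theta> lam = \<infinity> \<longrightarrow>
           extinction_prob M Z = 1 \<and>
           ((\<lambda>t. survival_prob M Z t /
                 (V_at M Z \<theta> lam t + \<theta> * inverse (1 + \<theta>) * mean_size M Z t powr (- \<theta>))
                   powr (- 1 / \<theta>)) \<longlongrightarrow> 1) at_top \<and>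
           ((\<lambda>t. conditional_mean_size M Z t /
                 (mean_size M Z t powr \<theta> * V_at M Z \<theta> lam t + \<theta> * inverse (1 + \<theta>))
                   powr (1 / \<theta>)) \<longlongrightarrow> 1) at_top)"
proof -
  define E where "E t = \<theta> * (LBINT u:{0..t}. lam u - a u * lam u)" for t
  define c where "c = inverse (1 + \<theta>)"
  define V where "V = V_at M Z \<theta> lam"
  define X where "X t = mean_size M Z t powr (- \<theta>)" for t
  define S where "S = survival_prob M Z"
  define I where "I t = (LBINT u:{0..t}. exp (E u) * lam u)" for t
  define B where "B t = (LBINT u:{0..t}. exp (E u) * (a u * lam u))" for t
  have par: "0 < \<theta>" "\<And>t. 0 \<le> t \<Longrightarrow> 0 \<le> lam t" "\<And>t. 0 \<le> t \<Longrightarrow> 0 \<le> a t" "\<And>t. 0 \<le> t \<Longrightarrow> a t \<le> 1 + 1 / \<theta>"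
    using assms unfolding theta_positive_process_def theta_parameters_def by auto
  note \<theta> = par(1)
  have c: "0 < c" using \<theta> by (simp add: c_def)
  note closed = theta_process_closed_form[OF assms, folded E_def]
  have mean_pos: "0 < mean_size M Z t" if "0 \<le> t" for t by (simp add: closed(1)[OF that])
  have X_eq: "X t = exp (E t)" if "0 \<le> t" for t
    using \<theta> by (simp add: X_def closed(1)[OF that] exp_powr_real)
  have V_eq: "V t = \<theta> * c * I t" for t
  proof -
    have "(LBINT u:{0..t}. mean_size M Z u powr (- \<theta>) * lam u) = I t"
      unfolding I_def by (rule set_lebesgue_integral_cong) (auto simp: X_eq[unfolded X_def])
    then show ?thesis by (simp add: V_def V_at_def c_def)
  qed
  have mono_integral: "(LBINT u:{0..s}. exp (E u) * f u) \<le> (LBINT u:{0..t}. exp (E u) * f u)"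
    if "0 \<le> s" "s \<le> t" "set_integrable lborel {0..t} (\<lambda>u. exp (E u) * f u)" "\<And>u. 0 \<le> u \<Longrightarrow> 0 \<le> f u" for s t f
    using set_integral_Icc_combine[OF that(1-3)] set_integral_Icc_nonneg[of "{s..t}" "\<lambda>u. exp (E u) * f u"] that
    by auto
  have I_mono: "I s \<le> I t" if "0 \<le> s" "s \<le> t" for s t
    unfolding I_def by (rule mono_integral) (use that par(2) closed(6)[of t] in auto)
  have B_mono: "B s \<le> B t" if "0 \<le> s" "s \<le> t" for s t
    unfolding B_def by (rule mono_integral) (use that par(2,3) closed(7)[of t] in auto)
  have I_nonneg: "0 \<le> I t" for t unfolding I_def by (rule set_integral_Icc_nonneg) (simp add: par(2))
  have V_mono: "V s \<le> V t" if "0 \<le> s" "s \<le> t" for s t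
    unfolding V_eq using I_mono[OF that] \<theta> c by (simp add: mult_left_mono)
  have V_nonneg: "0 \<le> V t" for t unfolding V_eq using I_nonneg \<theta> c by simp
  have B_le: "B t \<le> (1 + 1 / \<theta>) * I t" if t: "0 \<le> t" for t
  proof -
    have "B t \<le> (LBINT u:{0..t}. (1 + 1 / \<theta>) * (exp (E u) * lam u))"
      unfolding B_def
    proof (rule set_integral_mono)
      show "set_integrable lborel {0..t} (\<lambda>u. (1 + 1 / \<theta>) * (exp (E u) * lam u))"
        by (rule set_integrable_mult_right) (rule closed(6)[OF t])
      fix u assume "u \<in> {0..t}"
      then have "a u * lam u \<le> (1 + 1 / \<theta>) * lam u" using par(2,4) by (intro mult_right_mono) auto
      then have "exp (E u) * (a u * lam u) \<le> exp (E u) * ((1 + 1 / \<theta>) * lam u)" by (rule mult_left_mono) simp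
      then show "exp (E u) * (a u * lam u) \<le> (1 + 1 / \<theta>) * (exp (E u) * lam u)" by (simp only: mult.left_commute)
    qed (rule closed(7)[OF t])
    also have "\<dots> = (1 + 1 / \<theta>) * I t" unfolding I_def by (rule set_integral_mult_right)
    finally show ?thesis .
  qed
  have X_int: "X t = 1 + \<theta> * I t - \<theta> * B t" if "0 \<le> t" for t
    unfolding I_def B_def using X_eq[OF that] closed(8)[OF that] by simp
  have S_eq: "S t = (V t + c + \<theta> * c * X t) powr (- 1 / \<theta>)" if t: "0 \<le> t" for t
  proof -
    have "S t = (S t powr (- \<theta>)) powr (- 1 / \<theta>)"
      using powr_minus_inverse_powr[OF \<theta> closed(3)[OF t]] by (simp add: S_def)
    also have "S t powr (- \<theta>) = V t + c + \<theta> * c * X t"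
      unfolding S_def closed(2)[OF t] V_eq X_eq[OF t] c_def I_def by simp
    finally show ?thesis .
  qed
  have X_pos: "0 < X t" if "0 \<le> t" for t by (simp add: X_eq that)
  have mean_X: "mean_size M Z t = X t powr (- 1 / \<theta>)" if "0 \<le> t" for t
    unfolding X_def using powr_minus_inverse_powr[OF \<theta> mean_pos[OF that]] by simp
  have ev0: "\<forall>\<^sub>F t in at_top. (0::real) \<le> t" by (rule eventually_ge_at_top)
  have extinct: "extinction_prob M Z = 1 - s" if "(S \<longlongrightarrow> s) at_top" for s
  proof -
    have "((\<lambda>t. 1 - S t) \<longlongrightarrow> 1 - s) at_top" by (intro tendsto_intros that)
    then have "((\<lambda>t. measure M {\<omega> \<in> space M. Z t \<omega> = 0}) \<longlongrightarrow> 1 - s) at_top"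
      by (rule Lim_transform_eventually) (use ev0 in eventually_elim, simp add: closed(4) S_def)
    then show ?thesis unfolding extinction_prob_def by (intro tendsto_Lim) auto
  qed
  have V_lim_finite: "V_lim M Z \<theta> lam = ereal v" if "(V \<longlongrightarrow> v) at_top" for v
    unfolding V_lim_def V_def[symmetric] by (intro tendsto_Lim) (use that in auto)
  have V_lim_infinite: "V_lim M Z \<theta> lam = \<infinity>" if "filterlim V at_top at_top"
    unfolding V_lim_def V_def[symmetric]
    by (intro tendsto_Lim) (use that in \<open>auto simp: tendsto_PInfty_eq_at_top\<close>)
  have V_cases: "(\<exists>v. (V \<longlongrightarrow> v) at_top) \<or> filterlim V at_top at_top"
    by (rule mono_tendsto_or_at_top) (rule V_mono)
  show ?thesis
  proof (intro conjI impI)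
    assume fin: "V_lim M Z \<theta> lam < \<infinity>"
    with V_cases V_lim_infinite obtain v where v: "(V \<longlongrightarrow> v) at_top" by auto
    have I_lim: "(I \<longlongrightarrow> v / (\<theta> * c)) at_top"
    proof -
      have "((\<lambda>t. V t / (\<theta> * c)) \<longlongrightarrow> v / (\<theta> * c)) at_top" using \<theta> c by (intro tendsto_intros v) auto
      moreover have "V t / (\<theta> * c) = I t" for t using \<theta> c by (simp add: V_eq)
      ultimately show ?thesis by simp
    qed
    have I_le: "I t \<le> v / (\<theta> * c)" if "0 \<le> t" for t
      by (rule tendsto_lowerbound[OF I_lim]) (use eventually_mono[OF eventually_ge_at_top[of t] I_mono[OF that]] in simp_all)
    have "B t \<le> (1 + 1 / \<theta>) * (v / (\<theta> * c))" if "0 \<le> t" for t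
      using B_le[OF that] mult_left_mono[OF I_le[OF that], of "1 + 1 / \<theta>"] \<theta> by simp
    \<comment> \<open>\<open>X = \<mu>\<^bsup>-\<theta>\<^esup>\<close> is a difference of two bounded nondecreasing functions.\<close>
    then obtain b where b: "(B \<longlongrightarrow> b) at_top" using mono_bounded_tendsto_at_top[of B, OF B_mono] by blast
    obtain \<xi> where X_lim: "(X \<longlongrightarrow> \<xi>) at_top"
    proof
      have "((\<lambda>t. 1 + \<theta> * I t - \<theta> * B t) \<longlongrightarrow> 1 + \<theta> * (v / (\<theta> * c)) - \<theta> * b) at_top"
        by (intro tendsto_intros I_lim b)
      then show "(X \<longlongrightarrow> 1 + \<theta> * (v / (\<theta> * c)) - \<theta> * b) at_top"
        by (rule Lim_transform_eventually) (use ev0 in eventually_elim, simp add: X_int)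
    qed
    have \<xi>: "0 \<le> \<xi>"
      by (rule tendsto_lowerbound[OF X_lim]) (use eventually_mono[OF ev0 less_imp_le[OF X_pos]] in simp_all)
    have v0: "0 \<le> v" by (rule tendsto_lowerbound[OF v]) (auto simp: V_nonneg)
    define K where "K = v + c + \<theta> * c * \<xi>"
    have K: "0 < K" using v0 c \<xi> \<theta> by (simp add: K_def add_nonneg_pos add_pos_nonneg)
    have "((\<lambda>t. (V t + c + \<theta> * c * X t) powr (- 1 / \<theta>)) \<longlongrightarrow> K powr (- 1 / \<theta>)) at_top"
      using K unfolding K_def by (intro tendsto_intros v X_lim) auto
    then have "(S \<longlongrightarrow> K powr (- 1 / \<theta>)) at_top"
      by (rule Lim_transform_eventually) (use ev0 in eventually_elim, simp add: S_eq)
    then have q: "extinction_prob M Z = 1 - K powr (- 1 / \<theta>)" by (rule extinct)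
    then show "extinction_prob M Z < 1" using K by simp
    define \<mu> where "\<mu> = (if \<xi> = 0 then \<infinity> else ereal (\<xi> powr (- 1 / \<theta>)))"
    have "((\<lambda>t. ereal (X t powr (- 1 / \<theta>))) \<longlongrightarrow> \<mu>) at_top"
    proof (cases "\<xi> = 0")
      case True
      have "\<forall>\<^sub>F t in at_top. ereal r < ereal (X t powr (- 1 / \<theta>))" for r
      proof -
        \<comment> \<open>Only positive bounds can be raised to the power \<open>- \<theta>\<close>.\<close>
        define R where "R = max r 1"
        have R: "0 < R" "r \<le> R" by (auto simp: R_def)
        have "\<forall>\<^sub>F t in at_top. X t < R powr (- \<theta>)"
          using X_lim True R by (intro order_tendstoD(2)) auto
        then show ?thesis
          using ev0
        proof eventually_elim
          case (elim t)
          have "(R powr (- \<theta>)) powr (- 1 / \<theta>) < X t powr (- 1 / \<theta>)"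
            using elim X_pos[of t] \<theta> by (intro powr_less_mono2_neg) auto
          then show ?case using powr_minus_inverse_powr[OF \<theta> R(1)] R(2) by simp
        qed
      qed
      then show ?thesis by (simp add: \<mu>_def True tendsto_PInfty)
    next
      case False
      then show ?thesis using tendsto_powr[OF X_lim tendsto_const False] by (simp add: \<mu>_def)
    qed
    then have \<mu>_lim: "((\<lambda>t. ereal (mean_size M Z t)) \<longlongrightarrow> \<mu>) at_top"
      by (rule Lim_transform_eventually) (use ev0 in eventually_elim, simp add: mean_X)
    have \<mu>_pos: "0 < \<mu>" using \<xi> by (simp add: \<mu>_def)
    have "(if \<mu> = \<infinity> then 0 else real_of_ereal \<mu> powr (- \<theta>)) = \<xi>"
      using \<xi> \<theta> by (simp add: \<mu>_def powr_powr)
    then show "\<exists>\<mu>::ereal. ((\<lambda>t. ereal (mean_size M Z t)) \<longlongrightarrow> \<mu>) at_top \<and> 0 < \<mu> \<and>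
             extinction_prob M Z =
               1 - (real_of_ereal (V_lim M Z \<theta> lam) + inverse (1 + \<theta>)
                    + \<theta> * inverse (1 + \<theta>)
                      * (if \<mu> = \<infinity> then 0 else real_of_ereal \<mu> powr (- \<theta>)))
                   powr (- 1 / \<theta>)"
      using \<mu>_lim \<mu>_pos q V_lim_finite[OF v] by (intro exI[of _ \<mu>]) (simp add: K_def c_def)
  next
    assume inf: "V_lim M Z \<theta> lam = \<infinity>"
    with V_cases V_lim_finite have V_top: "filterlim V at_top at_top" by auto
    \<comment> \<open>The denominator of the first quotient is \<open>D\<^bsup>-1/\<theta>\<^esup>\<close>, while the survival probability is \<open>(c + D)\<^bsup>-1/\<theta>\<^esup>\<close>.\<close>
    define D where "D t = V t + \<theta> * c * X t" for t
    have D_ge: "V t \<le> D t" if "0 \<le> t" for t using X_pos[OF that] \<theta> c by (simp add: D_def)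
    have D_top: "filterlim D at_top at_top"
      by (rule filterlim_at_top_mono[OF V_top]) (use ev0 in eventually_elim, rule D_ge)
    have D_pos: "0 < D t" if "0 \<le> t" for t using V_nonneg[of t] X_pos[OF that] \<theta> c by (simp add: D_def add_nonneg_pos)
    have S_D: "S t = (c + D t) powr (- 1 / \<theta>)" if "0 \<le> t" for t
      using S_eq[OF that] by (simp add: D_def add_ac)
    have "((\<lambda>t. (c + D t) powr (- 1 / \<theta>)) \<longlongrightarrow> 0) at_top"
      using \<theta> by (intro tendsto_neg_powr filterlim_tendsto_add_at_top[OF tendsto_const D_top]) auto
    then have "(S \<longlongrightarrow> 0) at_top"
      by (rule Lim_transform_eventually) (use ev0 in eventually_elim, simp add: S_D)
    from extinct[OF this] show "extinction_prob M Z = 1" by simp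
    have "((\<lambda>t. c / D t) \<longlongrightarrow> 0) at_top"
      by (rule tendsto_divide_0[OF tendsto_const filterlim_at_top_imp_at_infinity[OF D_top]])
    then have "((\<lambda>t. (1 + c / D t) powr (- 1 / \<theta>)) \<longlongrightarrow> (1 + 0) powr (- 1 / \<theta>)) at_top"
      by (intro tendsto_intros) auto
    then have "((\<lambda>t. (1 + c / D t) powr (- 1 / \<theta>)) \<longlongrightarrow> 1) at_top" by simp
    then have ratio: "((\<lambda>t. S t / D t powr (- 1 / \<theta>)) \<longlongrightarrow> 1) at_top"
    proof (rule Lim_transform_eventually)
      show "\<forall>\<^sub>F t in at_top. (1 + c / D t) powr (- 1 / \<theta>) = S t / D t powr (- 1 / \<theta>)"
        using ev0
      proof eventually_elim
        case (elim t)
        have "1 + c / D t = (c + D t) / D t" using D_pos[OF elim] by (simp add: field_simps)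
        then show ?case using D_pos[OF elim] c by (simp add: S_D[OF elim] powr_divide)
      qed
    qed
    then show "((\<lambda>t. survival_prob M Z t /
                 (V_at M Z \<theta> lam t + \<theta> * inverse (1 + \<theta>) * mean_size M Z t powr (- \<theta>))
                   powr (- 1 / \<theta>)) \<longlongrightarrow> 1) at_top"
      by (simp add: S_def D_def V_def X_def c_def)
    have "((\<lambda>t. inverse (S t / D t powr (- 1 / \<theta>))) \<longlongrightarrow> inverse 1) at_top"
      by (intro tendsto_intros ratio) simp
    then have "((\<lambda>t. inverse (S t / D t powr (- 1 / \<theta>))) \<longlongrightarrow> 1) at_top" by simp
    then show "((\<lambda>t. conditional_mean_size M Z t /
                 (mean_size M Z t powr \<theta> * V_at M Z \<theta> lam t + \<theta> * inverse (1 + \<theta>))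
                   powr (1 / \<theta>)) \<longlongrightarrow> 1) at_top"
    proof (rule Lim_transform_eventually)
      show "\<forall>\<^sub>F t in at_top. inverse (S t / D t powr (- 1 / \<theta>)) = conditional_mean_size M Z t /
                 (mean_size M Z t powr \<theta> * V_at M Z \<theta> lam t + \<theta> * inverse (1 + \<theta>)) powr (1 / \<theta>)"
        using ev0
      proof eventually_elim
        case (elim t)
        note m = mean_pos[OF elim]
        \<comment> \<open>The quotient for the conditional mean is the reciprocal of the one for the survival probability.\<close>
        have "mean_size M Z t powr \<theta> * X t = 1" using m unfolding X_def by (simp flip: powr_add)
        then have "mean_size M Z t powr \<theta> * V_at M Z \<theta> lam t + \<theta> * inverse (1 + \<theta>) = mean_size M Z t powr \<theta> * D t"
          by (simp add: D_def V_def[symmetric] c_def[symmetric] algebra_simps)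
        also have "\<dots> powr (1 / \<theta>) = mean_size M Z t * D t powr (1 / \<theta>)"
          using m D_pos[OF elim] \<theta> by (simp add: powr_mult powr_powr)
        finally have denom: "(mean_size M Z t powr \<theta> * V_at M Z \<theta> lam t + \<theta> * inverse (1 + \<theta>)) powr (1 / \<theta>)
          = mean_size M Z t * D t powr (1 / \<theta>)" .
        have "D t powr (- 1 / \<theta>) = inverse (D t powr (1 / \<theta>))" by (simp flip: powr_minus)
        then show ?case
          unfolding denom closed(5)[OF elim] S_def using m by (simp add: divide_inverse)
      qed
    qed
  qed
qed

end
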